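(* Let $E=A\times B\subset\mathbb{R}^2$, where $A$ and $B$ are compact subsets of $\mathbb{R}$ with positive $s_A$-dimensional and positive $s_B$-dimensional Hausdorff measure, respectively. If $s_A+s_B+\max(s_A,s_B)>2$, then the Lebesgue measure of $\Delta(E)$ is positive. In particular, if $A,B\subset\mathbb{R}$ are compact, $E=A\times B$, $\dim_{\mathcal H}(E)=\dim_{\mathcal H}(A)+\dim_{\mathcal H}(B)$ and $\dim_{\mathcal H}(A)\neq\dim_{\mathcal H}(B)$, then $$\dim_{\mathcal H}(E)>\frac{4}{3}-\frac{|\dim_{\mathcal H}(A)-\dim_{\mathcal H}(B)|}{3}$$ implies that $\Delta(E)$ has positive Lebesgue measure.
   Context: For $E\subset\mathbb{R}^2$, the distance set is $\Delta(E)=\{|x-y|: x,y\in E\}\subset[0,\infty)$, where $|\cdot|$ is the Euclidean norm; its Lebesgue measure is one-dimensional Lebesgue measure. $\dim_{\mathcal H}$ denotes Hausdorff dimension. *)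

theory Defs
  imports "HOL-Analysis.Analysis"
begin

definition distance_set :: "'a::metric_space set \<Rightarrow> real set" where
  "distance_set E = {dist x y | x y. x \<in> E \<and> y \<in> E}"

(* diam(U)^s with the conventions diam({})^s = 0 for all s and diam(U)^0 = 1 for nonempty U.
   The second one has to be spelled out because 0 powr 0 = 0. *)
definition diam_pow :: "real \<Rightarrow> 'a::metric_space set \<Rightarrow> ennreal" where
  "diam_pow s U = (if U = {} then 0 else if s = 0 then 1 else ennreal (diameter U powr s))"

(* Boundedness is required explicitly because diameter is unspecified on unbounded sets.
   Finite covers are included by padding with the empty set. *)
definition hausdorff_premeasure :: "real \<Rightarrow> real \<Rightarrow> 'a::metric_space set \<Rightarrow> ennreal" where
  "hausdorff_premeasure s \<delta> S =
    (INF U \<in> {U :: nat \<Rightarrow> 'a set. S \<subseteq> (\<Union>i. U i) \<and> (\<forall>i. bounded (U i) \<and> diameter (U i) \<le> \<delta>)}.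
       \<Sum>i. diam_pow s (U i))"

(* The s-dimensional Hausdorff (outer) measure, for s \<ge> 0, without a normalising constant. *)
definition hausdorff_measure :: "real \<Rightarrow> 'a::metric_space set \<Rightarrow> ennreal" where
  "hausdorff_measure s S = (SUP \<delta> \<in> {0<..}. hausdorff_premeasure s \<delta> S)"

(* Real-valued: in a Euclidean space the s-dimensional measure vanishes for every s > DIM('a),
   so the infimum is over a nonempty set that is bounded below by 0. *)
definition hausdorff_dim :: "'a::euclidean_space set \<Rightarrow> real" where
  "hausdorff_dim S = Inf {s. 0 \<le> s \<and> hausdorff_measure s S = 0}"

end

theory Submission
  imports Defs "HOL-Probability.Probability"
begin

text \<open>By symmetry let \<open>s = s\<^sub>A \<ge> s\<^sub>B = t\<close>, so \<open>2 s + t > 2\<close>. Let \<open>\<mu>\<close> be an \<open>s\<close>-Frostman measure on \<open>A\<close>,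
  pin \<open>b\<^sub>0 \<in> B\<close>, and let \<open>\<tau>\<close> be a \<open>t\<close>-Frostman measure on \<open>{(b - b\<^sub>0)\<^sup>2 | b \<in> B}\<close>. The image \<open>\<sigma>\<close> of
  \<open>\<mu> \<times> \<mu> \<times> \<tau>\<close> under \<open>(a, a', u) \<mapsto> (a - a')\<^sup>2 + u\<close> lives on squared distances, and its Fourier transform
  factors as \<open>\<nu>(\<xi>) T(\<xi>)\<close> with \<open>T\<close> the transform of \<open>\<tau>\<close> and
  \<open>\<nu>(\<xi>) = \<integral>\<integral> exp (i \<xi> (a - a')\<^sup>2) d\<mu> d\<mu>\<close>. Expanding the square turns \<open>\<nu>\<close> into a
  bilinear Fourier form, for which the \<open>L\<^sup>2\<close> bound gives \<open>\<bar>\<nu>(\<xi>)\<bar>\<^sup>2 \<lesssim> \<bar>\<xi>\<bar>\<^bsup>1 - 2 s\<^esup>\<close>, while the integral of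
  \<open>\<bar>T(\<xi>)\<bar>\<^sup>2\<close> over \<open>\<bar>\<xi>\<bar> \<le> R\<close> is \<open>O(R\<^bsup>1 - t\<^esup>)\<close>. On the dyadic shell \<open>\<bar>\<xi>\<bar> \<sim> R\<close> this contributes
  \<open>R\<^bsup>2 - 2 s - t\<^esup>\<close>, so the Fourier transform of \<open>\<sigma>\<close> is square integrable and \<open>\<sigma>\<close> cannot live on a null set.\<close>

subsection \<open>Hausdorff measure and dimension\<close>

lemma hausdorff_premeasure_mono:
  assumes "S \<subseteq> T"
  shows "hausdorff_premeasure s \<delta> S \<le> hausdorff_premeasure s \<delta> T"
  unfolding hausdorff_premeasure_def using assms by (intro INF_superset_mono) auto

text \<open>Putting \<open>W\<close> in front of an admissible cover of \<open>S\<close> gives one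
  of \<open>S \<union> W\<close>. With \<open>W\<close> a short interval this becomes the Hoelder
  estimate of the Frostman function.\<close>

lemma hausdorff_premeasure_Un_le:
  assumes "bounded W" "diameter W \<le> \<delta>"
  shows "hausdorff_premeasure s \<delta> (S \<union> W) \<le> diam_pow s W + hausdorff_premeasure s \<delta> S"
proof -
  \<comment> \<open>With the finite term of \<open>W\<close> moved to the left, the right side is a
    single cover sum of \<open>S\<close>, and the infimum over covers can be taken.\<close>
  have "hausdorff_premeasure s \<delta> (S \<union> W) - diam_pow s W \<le> (\<Sum>i. diam_pow s (U i))"
    if U: "S \<subseteq> (\<Union>i. U i)" "\<forall>i. bounded (U i) \<and> diameter (U i) \<le> \<delta>" for U :: "nat \<Rightarrow> 'a set"
  proof -
    define V where "V = case_nat W U"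
    have "W = V 0" "U i = V (Suc i)" for i by (simp_all add: V_def)
    then have "W \<subseteq> (\<Union>i. V i)" "(\<Union>i. U i) \<subseteq> (\<Union>i. V i)"
      by blast+
    then have "S \<union> W \<subseteq> (\<Union>i. V i)"
      using U(1) by (meson Un_least order_trans)
    moreover have "\<forall>i. bounded (V i) \<and> diameter (V i) \<le> \<delta>"
      using U(2) assms by (auto simp: V_def split: nat.split)
    ultimately have "hausdorff_premeasure s \<delta> (S \<union> W) \<le> (\<Sum>i. diam_pow s (V i))"
      unfolding hausdorff_premeasure_def by (intro INF_lower) auto
    also have "\<dots> = (\<Sum>i. diam_pow s (V (i + 1))) + sum (\<lambda>i. diam_pow s (V i)) {..<1}"
      by (rule suminf_offset) simp
    also have "\<dots> = diam_pow s W + (\<Sum>i. diam_pow s (U i))"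
      by (simp add: V_def add.commute)
    finally show ?thesis
      by (auto simp: ennreal_minus_le_iff diam_pow_def)
  qed
  then have "hausdorff_premeasure s \<delta> (S \<union> W) - diam_pow s W \<le> hausdorff_premeasure s \<delta> S"
    unfolding hausdorff_premeasure_def[of s \<delta> S] by (intro INF_greatest) auto
  then show ?thesis
    by (simp add: ennreal_minus_le_iff)
qed

lemma hausdorff_premeasure_empty:
  assumes "\<delta> \<ge> 0"
  shows "hausdorff_premeasure s \<delta> ({} :: 'a::metric_space set) = 0"
proof -
  have "hausdorff_premeasure s \<delta> ({} :: 'a set) \<le> (\<Sum>i::nat. diam_pow s ({}::'a set))"
    unfolding hausdorff_premeasure_def using assms
    by (intro INF_lower2[where i = "\<lambda>_. {} :: 'a set"]) auto
  then show ?thesis by (simp add: diam_pow_def)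
qed

lemma hausdorff_measure_empty: "hausdorff_measure s ({} :: 'a::metric_space set) = 0"
  unfolding hausdorff_measure_def
  by (rule antisym[OF SUP_least]) (auto simp: hausdorff_premeasure_empty)

text \<open>A cover of a nonempty set has a nonempty member, which alone contributes
  \<open>1\<close>. This provides the exponent \<open>0\<close> when lowering a small dimension
  would give a negative one.\<close>

lemma hausdorff_measure_0_pos:
  assumes "S \<noteq> {}"
  shows "hausdorff_measure 0 S > 0"
proof -
  have "1 \<le> hausdorff_premeasure 0 1 S"
    unfolding hausdorff_premeasure_def
  proof (rule INF_greatest)
    fix U :: "nat \<Rightarrow> 'a set"
    assume "U \<in> {U. S \<subseteq> (\<Union>i. U i) \<and> (\<forall>i. bounded (U i) \<and> diameter (U i) \<le> 1)}"
    then have "S \<subseteq> (\<Union>i. U i)" by simp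
    with assms obtain i where "U i \<noteq> {}" by (metis UN_E all_not_in_conv subsetD)
    then have "1 = diam_pow 0 (U i)" by (simp add: diam_pow_def)
    also have "\<dots> \<le> (\<Sum>i. diam_pow 0 (U i))"
      using sum_le_suminf[OF summableI, of "{i}" "\<lambda>i. diam_pow 0 (U i)"] by simp
    finally show "1 \<le> (\<Sum>i. diam_pow 0 (U i))" .
  qed
  also have "\<dots> \<le> hausdorff_measure 0 S"
    unfolding hausdorff_measure_def by (rule SUP_upper) simp
  finally show ?thesis by (rule less_le_trans[OF zero_less_one])
qed

lemma hausdorff_measure_pos_below_dim:
  assumes "0 \<le> s" "s < hausdorff_dim S"
  shows "hausdorff_measure s S > 0"
proof (rule ccontr)
  assume "\<not> hausdorff_measure s S > 0"
  then have "hausdorff_dim S \<le> s"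
    unfolding hausdorff_dim_def using assms(1) by (intro cInf_lower bdd_belowI[of _ 0]) auto
  then show False using assms(2) by simp
qed

lemma hausdorff_dim_empty: "hausdorff_dim {} = 0"
  by (simp add: hausdorff_dim_def hausdorff_measure_empty flip: atLeast_def)

subsection \<open>Frostman measures and energy\<close>

text \<open>The Frostman condition. For a finite measure and \<open>s \<ge> 0\<close>, asking for
  all radii is no stronger than asking for small ones; for \<open>s = 0\<close> it only says that
  ball masses are bounded.\<close>

definition ball_bound :: "real \<Rightarrow> real measure \<Rightarrow> bool" where
  "ball_bound s M \<longleftrightarrow> (\<exists>C>0. \<forall>x. \<forall>r>0. measure M (cball x r) \<le> C * r powr s)"

text \<open>On the line no compactness argument is needed: the function
  \<open>x \<mapsto> \<H>\<^sup>s\<^sub>\<delta> (A \<inter> (-\<infinity>, x])\<close> is monotone, \<open>s\<close>-Hoelder at scales below \<open>\<delta>\<close> and constant on the gaps of \<open>A\<close>, so its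
  Stieltjes measure does the job.\<close>

lemma frostman_real:
  fixes A :: "real set"
  assumes A: "compact A" and s: "s > 0" and H: "hausdorff_measure s A > 0"
  obtains M where "sets M = sets borel" "finite_measure M" "measure M UNIV > 0"
    "emeasure M (- A) = 0" "ball_bound s M"
proof -
  \<comment> \<open>A positive supremum is positive at some scale; this one \<open>\<delta>\<close>
    stays fixed throughout.\<close>
  from H obtain \<delta> where \<delta>: "\<delta> > 0" and pos: "hausdorff_premeasure s \<delta> A > 0"
    unfolding hausdorff_measure_def by (auto simp: less_SUP_iff)
  define P where "P x = hausdorff_premeasure s \<delta> (A \<inter> {..x})" for x
  define F where "F x = enn2real (P x)" for x
  have P_mono: "P x \<le> P y" if "x \<le> y" for x y
    unfolding P_def using that by (intro hausdorff_premeasure_mono) auto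
  have P_step: "P y \<le> ennreal ((y - x) powr s) + P x" if "x < y" "y - x \<le> \<delta>" for x y
  proof -
    have d: "diameter {x..y} = y - x"
      using that(1) by simp
    have "P y \<le> hausdorff_premeasure s \<delta> (A \<inter> {..x} \<union> {x..y})"
      unfolding P_def by (intro hausdorff_premeasure_mono) auto
    also have "\<dots> \<le> diam_pow s {x..y} + P x"
      unfolding P_def by (intro hausdorff_premeasure_Un_le) (use d that in auto)
    also have "diam_pow s {x..y} = ennreal ((y - x) powr s)"
      using s d that by (simp add: diam_pow_def)
    finally show ?thesis .
  qed
  from A obtain k where k: "\<forall>x\<in>A. \<bar>x\<bar> \<le> k"
    using compact_imp_bounded bounded_real by metis
  \<comment> \<open>The margins of 1 put \<open>A\<close> strictly between \<open>l\<close> and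
    \<open>u\<close>, so that \<open>P\<close> vanishes at \<open>l\<close> and sees all of
    \<open>A\<close> at \<open>u\<close>.\<close>
  define l u where "l = - k - 1" and "u = k + 1"
  have l: "\<forall>x\<in>A. l < x" and u: "\<forall>x\<in>A. x < u"
    using k by (force simp: l_def u_def)+
  have P_l: "P l = 0"
  proof -
    have "A \<inter> {..l} = {}" using l by force
    then show ?thesis using \<delta> by (simp add: P_def hausdorff_premeasure_empty)
  qed
  \<comment> \<open>Each step of length \<open>\<delta>\<close> adds at most
    \<open>\<delta> powr s\<close>, so \<open>P\<close> is finite everywhere and
    \<open>enn2real\<close> loses nothing.\<close>
  have "P (l + real n * \<delta>) < \<infinity>" for n
  proof (induction n)
    case 0
    then show ?case using P_l by simp
  next
    case (Suc n)
    have "P (l + real (Suc n) * \<delta>) \<le> ennreal (\<delta> powr s) + P (l + real n * \<delta>)"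
      using P_step[of "l + real n * \<delta>" "l + real (Suc n) * \<delta>"] \<delta> by (simp add: algebra_simps)
    then show ?case using Suc by (auto simp: less_top[symmetric] top_unique)
  qed
  then have P_fin: "P x < \<infinity>" for x
  proof -
    obtain n where "(x - l) / \<delta> < real n" using reals_Archimedean2 by blast
    then have "x \<le> l + real n * \<delta>" using \<delta> by (simp add: field_simps)
    then show ?thesis using P_mono \<open>P (l + real n * \<delta>) < \<infinity>\<close> by (meson le_less_trans)
  qed
  have PF: "P x = ennreal (F x)" for x
    using P_fin[of x] by (simp add: F_def less_top)
  have F0: "F x \<ge> 0" for x by (simp add: F_def)
  have F_mono: "F x \<le> F y" if "x \<le> y" for x y
    using P_mono[OF that] by (simp add: PF F0)
  have F_step: "F y - F x \<le> (y - x) powr s" if "x \<le> y" "y - x \<le> \<delta>" for x y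
  proof (cases "x = y")
    case False
    then have "ennreal (F y) \<le> ennreal ((y - x) powr s + F x)"
      using P_step[of x y] that by (simp add: PF F0)
    then have "F y \<le> (y - x) powr s + F x" using F0 by (subst (asm) ennreal_le_iff) auto
    then show ?thesis by simp
  qed simp
  have F_gap: "F y = F x" if "x \<le> y" "A \<inter> {x..y} = {}" for x y
  proof -
    have "A \<inter> {..y} = A \<inter> {..x}" using that by fastforce
    then show ?thesis by (simp add: F_def P_def)
  qed
  have F_cont: "continuous_on UNIV F"
  proof (rule continuous_at_imp_continuous_on, rule ballI)
    fix x
    have "((\<lambda>y. F y - F x) \<longlongrightarrow> 0) (at x)"
    proof (rule tendsto_0_le[where K = 1])
      show "((\<lambda>y. \<bar>y - x\<bar> powr s) \<longlongrightarrow> 0) (at x)"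
        using s by (auto intro!: tendsto_eq_intros simp: tendsto_rabs_zero_iff)
      have "\<forall>\<^sub>F y in at x. dist y x < \<delta>"
        using \<delta> by (auto simp: eventually_at)
      then show "\<forall>\<^sub>F y in at x. norm (F y - F x) \<le> norm (\<bar>y - x\<bar> powr s) * 1"
      proof eventually_elim
        case (elim y)
        then show ?case
          using F_step[of x y] F_step[of y x] F_mono[of x y] F_mono[of y x]
          by (cases "x \<le> y") (auto simp: dist_real_def)
      qed
    qed
    then show "isCont F x"
      by (simp add: isCont_def LIM_zero_iff)
  qed
  define M where "M = interval_measure F"
  have sets: "sets M = sets borel" by (simp add: M_def)
  have Icc: "emeasure M {a..b} = ennreal (F b - F a)" if "a \<le> b" for a b
    unfolding M_def by (rule emeasure_interval_measure_Icc[OF that F_mono F_cont])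
  have null: "emeasure M (- A) = 0"
  proof -
    \<comment> \<open>The complement of \<open>A\<close> is a countable union of compact intervals,
      and \<open>F\<close> has no increment across any interval missing \<open>A\<close>.\<close>
    have "open (- A)" using A by (simp add: compact_imp_closed open_Compl)
    then obtain D :: "real set set" where D: "countable D" "D \<subseteq> Pow (- A)"
      "\<forall>X\<in>D. \<exists>a b. X = cbox a b" "\<Union>D = - A"
      by (metis open_countable_Union_open_cbox)
    have "X \<in> null_sets M" if XD: "X \<in> D" for X
    proof -
      obtain a b where X: "X = {a..b}" using D(3) XD by (metis cbox_interval)
      show ?thesis
      proof (cases "a \<le> b")
        case True
        have "A \<inter> {a..b} = {}" using D(2) XD X by auto
        then show ?thesis using Icc[OF True] F_gap[OF True] sets X by (auto simp: null_sets_def)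
      qed (use X in simp)
    qed
    then have "(\<Union>X\<in>D. X) \<in> null_sets M" using D(1) by (intro null_sets_UN') auto
    then show ?thesis using D(4) by auto
  qed
  have lu: "P u = hausdorff_premeasure s \<delta> A"
  proof -
    have "A \<inter> {..u} = A" using u by force
    then show ?thesis by (simp add: P_def)
  qed
  have Fl: "F l = 0" by (simp add: F_def P_l)
  have "0 < ennreal (F u)" using pos lu PF by metis
  then have Fu: "F u > 0" by simp
  have "A \<noteq> {}" using pos hausdorff_premeasure_empty[of \<delta> s, where 'a = real] \<delta> by force
  then have "l \<le> u" using l u by force
  have tot: "emeasure M UNIV = ennreal (F u)"
  proof -
    have "emeasure M UNIV = emeasure M ({l..u} \<union> - A)"
      using l u by (intro arg_cong[where f = "emeasure M"]) force
    also have "\<dots> = emeasure M {l..u}"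
      using null A sets by (intro emeasure_Un_null_set) (auto simp: null_sets_def compact_imp_closed)
    finally show ?thesis using Icc[OF \<open>l \<le> u\<close>] Fl by simp
  qed
  have fin: "finite_measure M"
    by (intro finite_measureI) (use tot in \<open>simp add: M_def\<close>)
  interpret finite_measure M by (rule fin)
  have mtot: "measure M UNIV = F u" using tot F0 by (simp add: measure_def)
  \<comment> \<open>The first summand serves balls of length \<open>2 * r \<le> \<delta>\<close>,
    where the Hoelder bound applies; the second bounds larger balls by the total mass
    \<open>F u\<close>.\<close>
  define C where "C = 2 powr s + F u / (\<delta> / 2) powr s"
  have C: "C > 0" using F0 \<delta> by (auto simp: C_def intro!: add_pos_nonneg)
  have "measure M (cball x r) \<le> C * r powr s" if r: "r > 0" for x r
  proof (cases "2 * r \<le> \<delta>")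
    case True
    have "measure M (cball x r) = F (x + r) - F (x - r)"
      using Icc[of "x - r" "x + r"] r F_mono[of "x - r" "x + r"]
      by (simp add: cball_eq_atLeastAtMost measure_def)
    also have "\<dots> \<le> (2 * r) powr s"
      using F_step[of "x - r" "x + r"] r True by (simp add: algebra_simps)
    also have "\<dots> \<le> C * r powr s"
      using F0 r by (simp add: C_def powr_mult algebra_simps)
    finally show ?thesis .
  next
    case False
    have "measure M (cball x r) \<le> measure M (space M)" by (rule bounded_measure)
    also have "\<dots> = F u" using mtot by (simp add: M_def)
    also have "\<dots> \<le> F u / (\<delta> / 2) powr s * r powr s"
    proof -
      have "1 \<le> r powr s / (\<delta> / 2) powr s"
        using False s \<delta> r by (simp add: powr_mono2)
      then show ?thesis using mult_left_mono[of 1 _ "F u"] F0[of u] by fastforce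
    qed
    also have "\<dots> \<le> C * r powr s"
      by (simp add: C_def algebra_simps)
    finally show ?thesis .
  qed
  then have "ball_bound s M" using C unfolding ball_bound_def by blast
  then show ?thesis using that sets fin mtot Fu null by metis
qed

text \<open>Cauchy-Schwarz for \<open>x \<mapsto> M (cball x \<delta>)\<close> on a small open neighbourhood of \<open>D\<close> containing all balls of
  radius \<open>\<delta>\<close> about points of \<open>D\<close>.\<close>

lemma pos_lborel_of_energy_bound:
  fixes D :: "real set"
  assumes D: "compact D" and sets: "sets M = sets borel" and fin: "finite_measure M"
    and pos: "measure M UNIV > 0" and null: "emeasure M (- D) = 0"
    and energy: "\<And>\<delta>. \<delta> > 0 \<Longrightarrow> (\<integral>\<^sup>+y. emeasure M (cball y \<delta>) \<partial>M) \<le> ennreal (C * \<delta>)"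
  shows "emeasure lborel D > 0"
proof (rule ccontr)
  assume "\<not> emeasure lborel D > 0"
  then have D0: "emeasure lborel D = 0" by simp
  note [measurable_cong] = sets
  interpret finite_measure M by (rule fin)
  interpret P: pair_sigma_finite lborel M ..
  define m where "m = measure M UNIV"
  have mM: "emeasure M UNIV = ennreal m" by (simp add: m_def emeasure_eq_measure)
  \<comment> \<open>Chosen so that \<open>\<bar>C\<bar> * e < m\<^sup>2\<close>, which the final
    estimate contradicts; the form \<open>\<bar>C\<bar> + 1\<close> allows any sign of
    \<open>C\<close>.\<close>
  define e where "e = m\<^sup>2 / (\<bar>C\<bar> + 1)"
  have m: "m > 0" using pos by (simp add: m_def)
  have e: "e > 0" using m by (simp add: e_def)
  have Db: "D \<in> sets borel" using D by (simp add: borel_compact)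
  obtain U where U: "open U" "D \<subseteq> U" "emeasure lborel (U - D) < ennreal e"
    using outer_regular_lborel[OF Db e] by blast
  have Ub[measurable]: "U \<in> sets borel" using U(1) by simp
  have U_le: "emeasure lborel U \<le> ennreal e"
  proof -
    have "emeasure lborel U \<le> emeasure lborel ((U - D) \<union> D)"
      using Db Ub by (intro emeasure_mono) auto
    also have "\<dots> \<le> emeasure lborel (U - D) + emeasure lborel D"
      using Db Ub by (intro emeasure_subadditive) auto
    finally show ?thesis using U(3) D0 by simp
  qed
  obtain \<delta> where \<delta>: "\<delta> > 0" "(\<Union>x\<in>D. cball x \<delta>) \<subseteq> U"
    using compact_subset_open_imp_cball_epsilon_subset[OF D U(1,2)] by metis
  define k :: "real \<Rightarrow> real \<Rightarrow> ennreal" where "k x y = indicator {y. dist x y \<le> \<delta>} y" for x y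
  have [measurable]: "case_prod k \<in> borel_measurable (borel \<Otimes>\<^sub>M borel)"
    unfolding k_def indicator_def case_prod_beta by measurable
  define f where "f x = (\<integral>\<^sup>+y. k x y \<partial>M)" for x
  have f_eq: "f x = emeasure M (cball x \<delta>)" for x
    unfolding f_def k_def by (subst nn_integral_indicator) (simp_all add: cball_def[symmetric])
  have [measurable]: "f \<in> borel_measurable borel"
    unfolding f_def by measurable
  have [measurable]: "(\<lambda>y. emeasure M (cball y (2 * \<delta>))) \<in> borel_measurable borel"
  proof -
    have "(\<lambda>y. emeasure M (cball y (2 * \<delta>))) = (\<lambda>y. \<integral>\<^sup>+z. indicator {z. dist y z \<le> 2 * \<delta>} z \<partial>M)"
      by (subst nn_integral_indicator) (simp_all add: cball_def[symmetric])
    also have "\<dots> \<in> borel_measurable borel"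
      unfolding indicator_def by measurable
    finally show ?thesis .
  qed
  have len: "(\<integral>\<^sup>+x. k x y \<partial>lborel) = ennreal (2 * \<delta>)" for y
  proof -
    have "(\<integral>\<^sup>+x. k x y \<partial>lborel) = (\<integral>\<^sup>+x. indicator (cball y \<delta>) x \<partial>lborel)"
      by (intro nn_integral_cong) (auto simp: k_def indicator_def dist_commute)
    also have "\<dots> = ennreal (2 * \<delta>)"
      using \<delta> by (simp add: cball_eq_atLeastAtMost)
    finally show ?thesis .
  qed
  \<comment> \<open>Balls of radius \<open>\<delta>\<close> about points of \<open>D\<close> lie in
    \<open>U\<close>, so the cutoff to \<open>U\<close> loses none of the integral of
    \<open>f\<close>.\<close>
  have "ennreal (2 * \<delta> * m) = (\<integral>\<^sup>+y. ennreal (2 * \<delta>) \<partial>M)"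
    using \<delta> m sets_eq_imp_space_eq[OF sets] mM by (simp add: ennreal_mult)
  also have "\<dots> = (\<integral>\<^sup>+y. \<integral>\<^sup>+x. k x y * indicator U x \<partial>lborel \<partial>M)"
  proof (rule nn_integral_cong_AE)
    have "- D \<in> null_sets M" using null Db sets by (simp add: null_sets_def)
    then have "AE y in M. y \<in> D" by (rule AE_I'[where N = "- D"]) auto
    then show "AE y in M. ennreal (2 * \<delta>) = (\<integral>\<^sup>+x. k x y * indicator U x \<partial>lborel)"
    proof eventually_elim
      case (elim y)
      have "cball y \<delta> \<subseteq> U" using elim \<delta>(2) by blast
      then have "k x y * indicator U x = k x y" for x
        by (auto simp: k_def indicator_def dist_commute subset_iff)
      then show ?case using len by simp
    qed
  qed
  also have "\<dots> = (\<integral>\<^sup>+x. \<integral>\<^sup>+y. k x y * indicator U x \<partial>M \<partial>lborel)"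
    by (rule P.Fubini') measurable
  also have "\<dots> = (\<integral>\<^sup>+x. f x * indicator U x \<partial>lborel)"
    unfolding f_def by (intro nn_integral_cong nn_integral_multc) measurable
  finally have eq: "ennreal (2 * \<delta> * m) = (\<integral>\<^sup>+x. f x * indicator U x \<partial>lborel)" .
  \<comment> \<open>One factor of the square is unfolded as an integral over \<open>y\<close>. For
    \<open>y\<close> within \<open>\<delta>\<close> of \<open>x\<close> the other is at most the
    mass of the ball of radius \<open>2 * \<delta>\<close> about \<open>y\<close>, which is free of
    \<open>x\<close>, so that \<open>x\<close> can be integrated out.\<close>
  have "(\<integral>\<^sup>+x. (f x)\<^sup>2 \<partial>lborel) \<le> (\<integral>\<^sup>+x. \<integral>\<^sup>+y. k x y * emeasure M (cball y (2 * \<delta>)) \<partial>M \<partial>lborel)"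
  proof (rule nn_integral_mono)
    fix x
    have "(f x)\<^sup>2 = (\<integral>\<^sup>+y. k x y * f x \<partial>M)"
      unfolding power2_eq_square by (subst (1) f_def, rule nn_integral_multc[symmetric]) measurable
    also have "\<dots> \<le> (\<integral>\<^sup>+y. k x y * emeasure M (cball y (2 * \<delta>)) \<partial>M)"
    proof (rule nn_integral_mono)
      fix y
      show "k x y * f x \<le> k x y * emeasure M (cball y (2 * \<delta>))"
      proof (cases "dist x y \<le> \<delta>")
        case True
        have "cball x \<delta> \<subseteq> cball y (2 * \<delta>)"
          using True by (auto simp: dist_real_def)
        then show ?thesis
          unfolding f_eq by (intro mult_left_mono emeasure_mono) (auto simp: sets)
      qed (simp add: k_def)
    qed
    finally show "(f x)\<^sup>2 \<le> (\<integral>\<^sup>+y. k x y * emeasure M (cball y (2 * \<delta>)) \<partial>M)" .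
  qed
  also have "(\<integral>\<^sup>+x. \<integral>\<^sup>+y. k x y * emeasure M (cball y (2 * \<delta>)) \<partial>M \<partial>lborel)
    = (\<integral>\<^sup>+y. \<integral>\<^sup>+x. k x y * emeasure M (cball y (2 * \<delta>)) \<partial>lborel \<partial>M)"
    by (rule P.Fubini'[symmetric]) measurable
  also have "\<dots> = (\<integral>\<^sup>+y. ennreal (2 * \<delta>) * emeasure M (cball y (2 * \<delta>)) \<partial>M)"
    by (intro nn_integral_cong, subst nn_integral_multc) (simp_all add: len)
  also have "\<dots> = ennreal (2 * \<delta>) * (\<integral>\<^sup>+y. emeasure M (cball y (2 * \<delta>)) \<partial>M)"
    by (rule nn_integral_cmult) measurable
  also have "\<dots> \<le> ennreal (2 * \<delta>) * ennreal (C * (2 * \<delta>))"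
    using energy[of "2 * \<delta>"] \<delta> by (intro mult_left_mono) auto
  also have "\<dots> \<le> ennreal (2 * \<delta>) * ennreal (\<bar>C\<bar> * (2 * \<delta>))"
    using \<delta> by (intro mult_left_mono ennreal_leI mult_right_mono) auto
  finally have f2: "(\<integral>\<^sup>+x. (f x)\<^sup>2 \<partial>lborel) \<le> ennreal (2 * \<delta>) * ennreal (\<bar>C\<bar> * (2 * \<delta>))" .
  \<comment> \<open>Both sides carry \<open>(2 * \<delta>)\<^sup>2\<close>, so the outcome
    \<open>m\<^sup>2 \<le> \<bar>C\<bar> * e\<close> is independent of the scale.\<close>
  have "(ennreal (2 * \<delta> * m))\<^sup>2 \<le> (\<integral>\<^sup>+x. (f x)\<^sup>2 \<partial>lborel) * (\<integral>\<^sup>+x. (indicator U x)\<^sup>2 \<partial>lborel)"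
    unfolding eq by (rule Cauchy_Schwarz_nn_integral) measurable
  also have "(\<integral>\<^sup>+x. (indicator U x)\<^sup>2 \<partial>lborel) = emeasure lborel U"
    by (simp add: power2_eq_square flip: indicator_inter_arith)
  also have "(\<integral>\<^sup>+x. (f x)\<^sup>2 \<partial>lborel) * emeasure lborel U \<le>
      ennreal (2 * \<delta>) * ennreal (\<bar>C\<bar> * (2 * \<delta>)) * ennreal e"
    by (intro mult_mono f2 U_le) auto
  also have "\<dots> = ennreal ((2 * \<delta>)\<^sup>2 * (\<bar>C\<bar> * e))"
    using \<delta> e by (simp add: ennreal_mult[symmetric] power2_eq_square algebra_simps)
  also have "(ennreal (2 * \<delta> * m))\<^sup>2 = ennreal ((2 * \<delta>)\<^sup>2 * m\<^sup>2)"
    using \<delta> m by (simp add: ennreal_power power_mult_distrib)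
  finally have "(2 * \<delta>)\<^sup>2 * m\<^sup>2 \<le> (2 * \<delta>)\<^sup>2 * (\<bar>C\<bar> * e)"
    using e by (subst (asm) ennreal_le_iff) auto
  then have "m\<^sup>2 \<le> \<bar>C\<bar> * e" using \<delta> by simp
  also have "\<dots> < m\<^sup>2"
    using m by (simp add: e_def field_simps)
  finally show False by simp
qed

subsection \<open>Gaussian \<open>L\<^sup>2\<close> averages of exponential sums\<close>

lemma summable_gauss_powr: "summable (\<lambda>k. exp (- (real k)\<^sup>2 / 2) * (real k + 1) powr s)"
proof (rule summable_comparison_test_bigo)
  show "summable (\<lambda>k. norm (1 / real k ^ 2))"
    using inverse_power_summable[of 2] by (simp add: inverse_eq_divide)
  show "(\<lambda>k. exp (- (real k)\<^sup>2 / 2) * (real k + 1) powr s) \<in> O(\<lambda>k. 1 / real k ^ 2)"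
    by real_asymp
qed

text \<open>Split the line by the integer part \<open>k\<close> of
  \<open>\<bar>R * (a - b)\<bar>\<close>. The weight there is at most
  \<open>exp (- k\<^sup>2 / 2)\<close>, the mass is bounded by that of a ball of radius
  \<open>(k + 1) / \<bar>R\<bar>\<close>, and the resulting series converges.\<close>

lemma gauss_integral_le:
  assumes sets: "sets M = sets borel" and fin: "finite_measure M" and bb: "ball_bound s M"
  obtains C where "C > 0"
    "\<And>R b. R \<noteq> 0 \<Longrightarrow> (\<integral>a. exp (- (R * (a - b))\<^sup>2 / 2) \<partial>M) \<le> C * \<bar>R\<bar> powr - s"
proof -
  note [measurable_cong] = sets
  interpret finite_measure M by (rule fin)
  obtain C0 where C0: "C0 > 0" "\<And>x r. r > 0 \<Longrightarrow> measure M (cball x r) \<le> C0 * r powr s"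
    using bb by (auto simp: ball_bound_def)
  define c where "c k = exp (- (real k)\<^sup>2 / 2) * (real k + 1) powr s" for k :: nat
  have c: "summable c" unfolding c_def by (rule summable_gauss_powr)
  have c0: "c k \<ge> 0" for k by (simp add: c_def)
  define C where "C = C0 * (suminf c + 1)"
  have "C > 0" unfolding C_def using C0 suminf_nonneg[OF c c0] by simp
  moreover have "(\<integral>a. exp (- (R * (a - b))\<^sup>2 / 2) \<partial>M) \<le> C * \<bar>R\<bar> powr - s" if R: "R \<noteq> 0" for R b
  proof -
    have pt: "ennreal (exp (- (R * (a - b))\<^sup>2 / 2)) \<le>
        (\<Sum>k. ennreal (exp (- (real k)\<^sup>2 / 2)) * indicator (cball b ((real k + 1) / \<bar>R\<bar>)) a)"
      (is "_ \<le> (\<Sum>k. ?h k)") for a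
    proof -
      define k where "k = nat \<lfloor>\<bar>R * (a - b)\<bar>\<rfloor>"
      have k: "real k \<le> \<bar>R * (a - b)\<bar>" "\<bar>R * (a - b)\<bar> \<le> real k + 1"
        unfolding k_def by linarith+
      have "(real k)\<^sup>2 \<le> (R * (a - b))\<^sup>2"
        using k(1) by (metis abs_le_square_iff abs_of_nat)
      moreover have "a \<in> cball b ((real k + 1) / \<bar>R\<bar>)"
        using k(2)[unfolded abs_mult] R by (simp add: dist_real_def pos_le_divide_eq abs_minus_commute mult.commute)
      ultimately have "ennreal (exp (- (R * (a - b))\<^sup>2 / 2)) \<le> ?h k"
        by (simp add: ennreal_leI)
      also have "\<dots> \<le> (\<Sum>k. ?h k)"
        using sum_le_suminf[OF summableI, of "{k}" ?h]
        by (simp only: sum.insert sum.empty finite.emptyI empty_iff not_False_eq_True add_0_right)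
           simp
      finally show ?thesis .
    qed
    have "(\<integral>\<^sup>+a. ennreal (exp (- (R * (a - b))\<^sup>2 / 2)) \<partial>M) \<le>
        (\<integral>\<^sup>+a. (\<Sum>k. ennreal (exp (- (real k)\<^sup>2 / 2)) * indicator (cball b ((real k + 1) / \<bar>R\<bar>)) a) \<partial>M)"
      by (intro nn_integral_mono pt)
    also have "\<dots> = (\<Sum>k. \<integral>\<^sup>+a. ennreal (exp (- (real k)\<^sup>2 / 2)) * indicator (cball b ((real k + 1) / \<bar>R\<bar>)) a \<partial>M)"
      by (rule nn_integral_suminf)
         (intro borel_measurable_times_ennreal borel_measurable_const borel_measurable_indicator, simp add: sets)
    also have "\<dots> \<le> (\<Sum>k. ennreal (C0 * \<bar>R\<bar> powr - s * c k))"
    proof (intro suminf_le summableI)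
      fix k
      have "(\<integral>\<^sup>+a. ennreal (exp (- (real k)\<^sup>2 / 2)) * indicator (cball b ((real k + 1) / \<bar>R\<bar>)) a \<partial>M)
          = ennreal (exp (- (real k)\<^sup>2 / 2)) * ennreal (measure M (cball b ((real k + 1) / \<bar>R\<bar>)))"
        by (subst nn_integral_cmult_indicator) (auto simp: emeasure_eq_measure sets)
      also have "\<dots> \<le> ennreal (exp (- (real k)\<^sup>2 / 2)) * ennreal (C0 * ((real k + 1) / \<bar>R\<bar>) powr s)"
        using C0(2) R by (intro mult_left_mono ennreal_leI) auto
      also have "\<dots> = ennreal (C0 * \<bar>R\<bar> powr - s * c k)"
        using C0 R by (simp add: c_def powr_divide powr_minus field_simps flip: ennreal_mult)
      finally show "(\<integral>\<^sup>+a. ennreal (exp (- (real k)\<^sup>2 / 2)) * indicator (cball b ((real k + 1) / \<bar>R\<bar>)) a \<partial>M)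
          \<le> ennreal (C0 * \<bar>R\<bar> powr - s * c k)" .
    qed
    also have "\<dots> = ennreal (C0 * \<bar>R\<bar> powr - s * suminf c)"
      using c c0 C0 by (subst suminf_ennreal2) (auto simp: suminf_mult intro: summable_mult)
    also have "\<dots> \<le> ennreal (C * \<bar>R\<bar> powr - s)"
      using C0 by (intro ennreal_leI) (simp add: C_def algebra_simps)
    finally have *: "(\<integral>\<^sup>+a. ennreal (exp (- (R * (a - b))\<^sup>2 / 2)) \<partial>M) \<le> ennreal (C * \<bar>R\<bar> powr - s)" .
    have "(\<integral>a. exp (- (R * (a - b))\<^sup>2 / 2) \<partial>M) = enn2real (\<integral>\<^sup>+a. ennreal (exp (- (R * (a - b))\<^sup>2 / 2)) \<partial>M)"
      by (rule integral_eq_nn_integral) auto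
    also have "\<dots> \<le> C * \<bar>R\<bar> powr - s"
      using enn2real_mono[OF *] \<open>C > 0\<close> by simp
    finally show ?thesis .
  qed
  ultimately show ?thesis using that by blast
qed

abbreviation "gauss \<equiv> std_normal_distribution"

lemma prob_space_gauss: "prob_space gauss"
  by (rule prob_space_normal_density) simp

lemma cis_measurable [measurable]: "cis \<in> borel_measurable borel"
  by (intro borel_measurable_continuous_onI continuous_intros)

lemma cnj_measurable [measurable]: "cnj \<in> borel_measurable borel"
  by (intro borel_measurable_continuous_onI continuous_intros)

text \<open>Write the squared norm as a double integral and average in \<open>x\<close> first: this
  leaves the characteristic function of the Gaussian at \<open>R\<close> times the difference of the
  two points. The identity takes the place of Plancherel.\<close>

lemma gauss_L2_eq:
  fixes g :: "real \<Rightarrow> complex"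
  assumes sets: "sets M = sets borel" and fin: "finite_measure M"
    and [measurable]: "g \<in> borel_measurable borel" and B: "\<And>a. norm (g a) \<le> B"
  shows "complex_of_real (\<integral>x. (norm (\<integral>a. g a * cis (R * a * x) \<partial>M))\<^sup>2 \<partial>gauss) =
    (\<integral>p. g (fst p) * cnj (g (snd p)) * of_real (exp (- (R * (fst p - snd p))\<^sup>2 / 2)) \<partial>(M \<Otimes>\<^sub>M M))"
proof -
  note [measurable_cong] = sets
  have B0: "B \<ge> 0" using B[of 0] norm_ge_zero order_trans by blast
  interpret finite_measure M by (rule fin)
  interpret N: prob_space gauss by (rule prob_space_gauss)
  interpret MM: pair_sigma_finite M M ..
  have finP: "finite_measure (M \<Otimes>\<^sub>M M)" by (rule finite_measure_pair_measure[OF fin fin])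
  interpret P: finite_measure "M \<Otimes>\<^sub>M M" by (rule finP)
  interpret NP: pair_sigma_finite gauss "M \<Otimes>\<^sub>M M" ..
  have finNP: "finite_measure (gauss \<Otimes>\<^sub>M (M \<Otimes>\<^sub>M M))"
    by (rule finite_measure_pair_measure[OF finP N.finite_measure_axioms])
  define G where "G x = (\<integral>a. g a * cis (R * a * x) \<partial>M)" for x
  define h where "h x p = (g (fst p) * cis (R * fst p * x)) * cnj (g (snd p) * cis (R * snd p * x))" for x p
  have h_m: "(\<lambda>(x, p). h x p) \<in> borel_measurable (gauss \<Otimes>\<^sub>M (M \<Otimes>\<^sub>M M))"
    unfolding h_def by measurable
  have hB: "norm (h x p) \<le> B\<^sup>2" for x p
    using B B0 by (auto simp: h_def norm_mult power2_eq_square intro!: mult_mono)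
  have GG: "G x * cnj (G x) = (\<integral>p. h x p \<partial>(M \<Otimes>\<^sub>M M))" for x
  proof -
    have "integrable (M \<Otimes>\<^sub>M M) (h x)"
      by (intro P.integrable_const_bound[where B = "B\<^sup>2"] AE_I2 hB) (unfold h_def, measurable)
    then have "(\<integral>p. h x p \<partial>(M \<Otimes>\<^sub>M M)) = (\<integral>a. \<integral>b. h x (a, b) \<partial>M \<partial>M)"
      using MM.integral_fst'[of "h x"] by simp
    also have "\<dots> = (\<integral>a. g a * cis (R * a * x) * (\<integral>b. cnj (g b * cis (R * b * x)) \<partial>M) \<partial>M)"
      unfolding h_def by simp
    also have "\<dots> = G x * cnj (G x)"
      unfolding G_def by (simp only: Bochner_Integration.integral_cnj integral_mult_left_zero)
    finally show ?thesis by simp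
  qed
  have "complex_of_real (\<integral>x. (norm (G x))\<^sup>2 \<partial>gauss) = (\<integral>x. complex_of_real ((norm (G x))\<^sup>2) \<partial>gauss)"
    by (rule integral_complex_of_real[symmetric])
  also have "\<dots> = (\<integral>x. \<integral>p. h x p \<partial>(M \<Otimes>\<^sub>M M) \<partial>gauss)"
    by (simp only: complex_norm_square GG)
  also have "\<dots> = (\<integral>p. \<integral>x. h x p \<partial>gauss \<partial>(M \<Otimes>\<^sub>M M))"
    by (rule NP.Fubini_integral[symmetric], rule finite_measure.integrable_const_bound[OF finNP, where B = "B\<^sup>2"])
       (use h_m hB in auto)
  also have "\<dots> = (\<integral>p. g (fst p) * cnj (g (snd p)) * of_real (exp (- (R * (fst p - snd p))\<^sup>2 / 2)) \<partial>(M \<Otimes>\<^sub>M M))"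
  proof (rule Bochner_Integration.integral_cong[OF refl])
    fix p :: "real \<times> real"
    have "h x p = g (fst p) * cnj (g (snd p)) * cis (R * (fst p - snd p) * x)" for x
      by (simp add: h_def cis_cnj cis_mult algebra_simps)
    then have "(\<integral>x. h x p \<partial>gauss) = g (fst p) * cnj (g (snd p)) * char gauss (R * (fst p - snd p))"
      by (simp add: char_def cis_conv_exp)
    then show "(\<integral>x. h x p \<partial>gauss) = g (fst p) * cnj (g (snd p)) * of_real (exp (- (R * (fst p - snd p))\<^sup>2 / 2))"
      by (simp add: char_std_normal_distribution)
  qed
  finally show ?thesis unfolding G_def .
qed

text \<open>Bounding \<open>g\<close> by \<open>B\<close> leaves the Gaussian kernel, whose integral
  in one variable decays by the ball condition. \<open>C\<close> is chosen before \<open>R\<close>,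
  \<open>B\<close> and \<open>g\<close>, since these vary later while the constant must not.\<close>

lemma gauss_L2_le:
  assumes sets: "sets M = sets borel" and fin: "finite_measure M" and bb: "ball_bound s M"
  shows "\<exists>C>0. \<forall>R B (g :: real \<Rightarrow> complex). R \<noteq> 0 \<longrightarrow> g \<in> borel_measurable borel \<longrightarrow> (\<forall>a. norm (g a) \<le> B) \<longrightarrow>
      (\<integral>x. (norm (\<integral>a. g a * cis (R * a * x) \<partial>M))\<^sup>2 \<partial>gauss) \<le> C * B\<^sup>2 * \<bar>R\<bar> powr - s"
proof -
  note [measurable_cong] = sets
  interpret finite_measure M by (rule fin)
  interpret MM: pair_sigma_finite M M ..
  interpret P: finite_measure "M \<Otimes>\<^sub>M M" by (rule finite_measure_pair_measure[OF fin fin])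
  obtain C0 where C0: "C0 > 0"
    "\<And>R b. R \<noteq> 0 \<Longrightarrow> (\<integral>a. exp (- (R * (a - b))\<^sup>2 / 2) \<partial>M) \<le> C0 * \<bar>R\<bar> powr - s"
    using gauss_integral_le[OF sets fin bb] by metis
  \<comment> \<open>The \<open>+ 1\<close> keeps \<open>C\<close> positive for the zero
    measure.\<close>
  define C where "C = C0 * (measure M (space M) + 1)"
  have "C > 0" using C0 by (auto simp: C_def intro!: mult_pos_pos add_nonneg_pos)
  moreover have "(\<integral>x. (norm (\<integral>a. g a * cis (R * a * x) \<partial>M))\<^sup>2 \<partial>gauss) \<le> C * B\<^sup>2 * \<bar>R\<bar> powr - s"
    if R: "R \<noteq> 0" and [measurable]: "g \<in> borel_measurable borel" and B: "\<And>a. norm (g a) \<le> B"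
    for R B and g :: "real \<Rightarrow> complex"
  proof -
    have B0: "B \<ge> 0" using B[of 0] norm_ge_zero order_trans by blast
    define E where "E p = exp (- (R * (fst p - snd p))\<^sup>2 / 2)" for p :: "real \<times> real"
    have [measurable]: "E \<in> borel_measurable (M \<Otimes>\<^sub>M M)"
      unfolding E_def by measurable
    have intE: "integrable (M \<Otimes>\<^sub>M M) E"
      by (intro P.integrable_const_bound[where B = 1] AE_I2) (auto simp: E_def)
    have "(\<integral>p. E p \<partial>(M \<Otimes>\<^sub>M M)) = (\<integral>b. \<integral>a. E (a, b) \<partial>M \<partial>M)"
      using MM.integral_snd[of "\<lambda>a b. E (a, b)"] intE by simp
    also have "\<dots> \<le> (\<integral>b. C0 * \<bar>R\<bar> powr - s \<partial>M)"
      using C0 R by (intro integral_mono') (auto simp: E_def)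
    also have "\<dots> \<le> C * \<bar>R\<bar> powr - s"
      using C0 by (simp add: C_def algebra_simps)
    finally have EC: "(\<integral>p. E p \<partial>(M \<Otimes>\<^sub>M M)) \<le> C * \<bar>R\<bar> powr - s" .
    have pt: "norm (g (fst p) * cnj (g (snd p)) * of_real (E p)) \<le> B\<^sup>2 * E p" for p
      using B B0 by (auto simp: norm_mult power2_eq_square E_def intro!: mult_mono)
    have "(\<integral>x. (norm (\<integral>a. g a * cis (R * a * x) \<partial>M))\<^sup>2 \<partial>gauss)
      = norm (complex_of_real (\<integral>x. (norm (\<integral>a. g a * cis (R * a * x) \<partial>M))\<^sup>2 \<partial>gauss))"
      by (subst norm_of_real, subst abs_of_nonneg) (auto intro!: integral_nonneg_AE)
    also have "\<dots> = norm (\<integral>p. g (fst p) * cnj (g (snd p)) * of_real (E p) \<partial>(M \<Otimes>\<^sub>M M))"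
      by (subst gauss_L2_eq[OF sets fin that(2) B]) (simp add: E_def)
    also have "\<dots> \<le> (\<integral>p. norm (g (fst p) * cnj (g (snd p)) * of_real (E p)) \<partial>(M \<Otimes>\<^sub>M M))"
      by (rule integral_norm_bound)
    also have "\<dots> \<le> (\<integral>p. B\<^sup>2 * E p \<partial>(M \<Otimes>\<^sub>M M))"
      by (intro integral_mono' pt integrable_mult_right intE) (simp add: E_def)
    also have "\<dots> = B\<^sup>2 * (\<integral>p. E p \<partial>(M \<Otimes>\<^sub>M M))" by simp
    also have "\<dots> \<le> B\<^sup>2 * (C * \<bar>R\<bar> powr - s)"
      by (intro mult_left_mono EC) simp
    finally show ?thesis by (simp add: algebra_simps)
  qed
  ultimately show ?thesis by blast
qed

subsection \<open>Decay of the quadratic exponential integral\<close>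

text \<open>Cauchy-Schwarz against the constant \<open>1\<close>; in \<open>ennreal\<close> the
  integral of the square may be infinite.\<close>

lemma ennreal_norm_integral_square_le:
  fixes f :: "'a \<Rightarrow> complex"
  assumes "integrable M f"
  shows "(ennreal (norm (\<integral>x. f x \<partial>M)))\<^sup>2 \<le> (\<integral>\<^sup>+x. (ennreal (norm (f x)))\<^sup>2 \<partial>M) * emeasure M (space M)"
proof -
  have "(ennreal (norm (\<integral>x. f x \<partial>M)))\<^sup>2 \<le> (\<integral>\<^sup>+x. ennreal (norm (f x)) * 1 \<partial>M)\<^sup>2"
    using integral_norm_bound_ennreal[OF assms] by (intro power_mono) auto
  also have "\<dots> \<le> (\<integral>\<^sup>+x. (ennreal (norm (f x)))\<^sup>2 \<partial>M) * (\<integral>\<^sup>+x. 1\<^sup>2 \<partial>M)"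
    using assms by (intro Cauchy_Schwarz_nn_integral) auto
  finally show ?thesis by simp
qed

text \<open>The substitution \<open>x = b + h * y\<close>.\<close>

lemma nn_integral_gauss_shift:
  assumes [measurable]: "f \<in> borel_measurable borel" and h: "h > 0"
  shows "(\<integral>\<^sup>+y. f (b + h * y) \<partial>gauss) = ennreal (1 / h) * (\<integral>\<^sup>+x. f x * std_normal_density ((x - b) / h) \<partial>lborel)"
proof -
  have "(\<integral>\<^sup>+x. f x * std_normal_density ((x - b) / h) \<partial>lborel)
      = ennreal h * (\<integral>\<^sup>+y. f (b + h * y) * std_normal_density y \<partial>lborel)"
    using h by (subst nn_integral_real_affine[where c = h and t = b]) auto
  also have "(\<integral>\<^sup>+y. f (b + h * y) * std_normal_density y \<partial>lborel) = (\<integral>\<^sup>+y. f (b + h * y) \<partial>gauss)"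
    by (subst nn_integral_density) (auto simp: mult.commute)
  finally have "ennreal (1 / h) * (\<integral>\<^sup>+x. f x * std_normal_density ((x - b) / h) \<partial>lborel)
      = ennreal (1 / h * h) * (\<integral>\<^sup>+y. f (b + h * y) \<partial>gauss)"
    using h by (simp only: ennreal_mult mult.assoc less_imp_le divide_nonneg_nonneg zero_le_one)
  then show ?thesis using h by simp
qed

text \<open>Averaging \<open>x \<mapsto> cis (- 2 R a x)\<close> against a Gaussian of width \<open>h = 1 / (2 \<bar>R\<bar>)\<close> about \<open>b\<close> yields
  \<open>exp (- a\<^sup>2 / 2) cis (- 2 R a b)\<close>. Since \<open>a\<close> is bounded, the first factor can be divided out, which trades
  the measure in \<open>b\<close> for a Lebesgue integral in \<open>x\<close>.\<close>

lemma quadratic_phase_decay: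
  assumes sets: "sets M = sets borel" and fin: "finite_measure M" and bb: "ball_bound s M"
    and supp: "emeasure M (- {-K..K}) = 0"
  shows "\<exists>C>0. \<forall>R. \<bar>R\<bar> \<ge> 1 \<longrightarrow> (norm (\<integral>p. cis (R * (fst p - snd p)\<^sup>2) \<partial>(M \<Otimes>\<^sub>M M)))\<^sup>2 \<le> C * \<bar>R\<bar> powr (1 - 2 * s)"
proof -
  note [measurable_cong] = sets
  interpret finite_measure M by (rule fin)
  interpret N: prob_space gauss by (rule prob_space_gauss)
  interpret MM: pair_sigma_finite M M ..
  interpret NM: pair_sigma_finite gauss M ..
  interpret LM: pair_sigma_finite lborel M ..
  interpret P: finite_measure "M \<Otimes>\<^sub>M M" by (rule finite_measure_pair_measure[OF fin fin])
  interpret Q: finite_measure "gauss \<Otimes>\<^sub>M M" by (rule finite_measure_pair_measure[OF fin N.finite_measure_axioms])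
  obtain C0 where C0: "C0 > 0"
    "\<And>R b. R \<noteq> 0 \<Longrightarrow> (\<integral>a. exp (- (R * (a - b))\<^sup>2 / 2) \<partial>M) \<le> C0 * \<bar>R\<bar> powr - s"
    using gauss_integral_le[OF sets fin bb] by metis
  obtain C1 where "C1 > 0" and "\<forall>R B (g :: real \<Rightarrow> complex). R \<noteq> 0 \<longrightarrow> g \<in> borel_measurable borel \<longrightarrow>
      (\<forall>a. norm (g a) \<le> B) \<longrightarrow>
      (\<integral>x. (norm (\<integral>a. g a * cis (R * a * x) \<partial>M))\<^sup>2 \<partial>gauss) \<le> C1 * B\<^sup>2 * \<bar>R\<bar> powr - s"
    using gauss_L2_le[OF sets fin bb] by blast
  note C1 = this[rule_format]
  have AE_K: "AE a in M. a \<in> {-K..K}"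
    by (rule AE_I'[where N = "- {-K..K}"]) (use supp sets in \<open>auto simp: null_sets_def\<close>)
  define B where "B = exp (K\<^sup>2 / 2)"
  define m where "m = measure M (space M)"
  define C where "C = 2 * exp (K\<^sup>2) * C0 * sqrt 2 powr s * (C1 * B\<^sup>2 * 2 powr - s * 2 powr - s) * (m + 1)"
  have "m \<ge> 0" by (simp add: m_def)
  then have "C > 0" using C0 C1 by (simp add: C_def B_def)
  moreover have "(norm (\<integral>p. cis (R * (fst p - snd p)\<^sup>2) \<partial>(M \<Otimes>\<^sub>M M)))\<^sup>2 \<le> C * \<bar>R\<bar> powr (1 - 2 * s)"
    if R: "\<bar>R\<bar> \<ge> 1" for R
  proof -
    define h where "h = 1 / (2 * \<bar>R\<bar>)"
    have h: "0 < h" "h \<le> 1 / 2" using R by (auto simp: h_def field_simps)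
    \<comment> \<open>The factor \<open>exp (a\<^sup>2 / 2)\<close> undoes the Gaussian damping; the
      cutoff, which holds almost everywhere, keeps it below \<open>B\<close>.\<close>
    define g where "g a = indicator {-K..K} a * cis (R * a\<^sup>2) * of_real (exp (a\<^sup>2 / 2))" for a
    have [measurable]: "g \<in> borel_measurable borel" unfolding g_def by measurable
    have B0: "B \<ge> 0" by (simp add: B_def)
    have gB: "norm (g a) \<le> B" for a
      by (auto simp: g_def B_def norm_mult indicator_def abs_le_square_iff[symmetric])
    define G where "G x = (\<integral>a. g a * cis (- 2 * R * a * x) \<partial>M)" for x
    have [measurable]: "G \<in> borel_measurable borel" unfolding G_def by measurable
    have GB: "norm (G x) \<le> B * m" for x
    proof -
      have "norm (G x) \<le> (\<integral>a. norm (g a * cis (- 2 * R * a * x)) \<partial>M)"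
        unfolding G_def by (rule integral_norm_bound)
      also have "\<dots> \<le> (\<integral>a. B \<partial>M)"
        by (rule integral_mono') (auto simp: norm_mult gB B0)
      finally show ?thesis by (simp add: m_def mult.commute)
    qed
    define J where "J b = (\<integral>a. cis (R * (a - b)\<^sup>2) \<partial>M)" for b
    have [measurable]: "J \<in> borel_measurable borel" unfolding J_def by measurable
    \<comment> \<open>Expand \<open>(a - b)\<^sup>2\<close>. After Fubini the integral over
      \<open>y\<close> is the Gaussian characteristic function at \<open>- 2 * R * a * h\<close>,
      whose square is \<open>a\<^sup>2\<close> by the choice of \<open>h\<close>, so it cancels the
      factor in \<open>g\<close>.\<close>
    have J_eq: "J b = cis (R * b\<^sup>2) * (\<integral>y. G (b + h * y) \<partial>gauss)" for b
    proof -
      have "(\<integral>y. G (b + h * y) \<partial>gauss) = (\<integral>a. \<integral>y. g a * cis (- 2 * R * a * (b + h * y)) \<partial>gauss \<partial>M)"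
        unfolding G_def
        by (rule NM.Fubini_integral[symmetric], rule Q.integrable_const_bound[where B = B])
           (auto simp: norm_mult gB)
      also have "\<dots> = (\<integral>a. cis (R * (a - b)\<^sup>2) * cis (- (R * b\<^sup>2)) \<partial>M)"
      proof (rule integral_cong_AE)
        show "AE a in M. (\<integral>y. g a * cis (- 2 * R * a * (b + h * y)) \<partial>gauss) = cis (R * (a - b)\<^sup>2) * cis (- (R * b\<^sup>2))"
          using AE_K
        proof eventually_elim
          case (elim a)
          have "g a * cis (- 2 * R * a * (b + h * y)) = g a * cis (- 2 * R * a * b) * cis (- 2 * R * a * h * y)" for y
            by (simp add: cis_mult algebra_simps)
          then have "(\<integral>y. g a * cis (- 2 * R * a * (b + h * y)) \<partial>gauss) = g a * cis (- 2 * R * a * b) * char gauss (- 2 * R * a * h)"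
            by (simp only: integral_mult_right_zero char_def cis_conv_exp)
          also have "(- 2 * R * a * h)\<^sup>2 = a\<^sup>2"
            using R by (simp add: h_def power_mult_distrib power_divide)
          then have "char gauss (- 2 * R * a * h) = of_real (exp (- a\<^sup>2 / 2))"
            by (simp add: char_std_normal_distribution)
          also have "g a * cis (- 2 * R * a * b) * of_real (exp (- a\<^sup>2 / 2))
              = cis (R * a\<^sup>2) * cis (- 2 * R * a * b) * of_real (exp (a\<^sup>2 / 2) * exp (- a\<^sup>2 / 2))"
            using elim by (simp add: g_def)
          also have "exp (a\<^sup>2 / 2) * exp (- a\<^sup>2 / 2) = (1 :: real)"
            by (simp flip: exp_add)
          finally show ?case
            by (simp add: cis_mult power2_eq_square algebra_simps)
        qed
      qed measurable
      also have "\<dots> = J b * cis (- (R * b\<^sup>2))" by (simp add: J_def)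
      finally show ?thesis by (simp add: cis_mult)
    qed
    have J_le: "(ennreal (norm (J b)))\<^sup>2 \<le> ennreal (1 / h) * (\<integral>\<^sup>+x. (ennreal (norm (G x)))\<^sup>2 * std_normal_density ((x - b) / h) \<partial>lborel)" for b
    proof -
      have "(ennreal (norm (J b)))\<^sup>2 = (ennreal (norm (\<integral>y. G (b + h * y) \<partial>gauss)))\<^sup>2"
        by (simp add: J_eq norm_mult)
      also have "\<dots> \<le> (\<integral>\<^sup>+y. (ennreal (norm (G (b + h * y))))\<^sup>2 \<partial>gauss) * emeasure gauss (space gauss)"
        by (rule ennreal_norm_integral_square_le, rule N.integrable_const_bound[where B = "B * m"])
           (auto simp: GB)
      also have "\<dots> = (\<integral>\<^sup>+y. (ennreal (norm (G (b + h * y))))\<^sup>2 \<partial>gauss)"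
        by (simp only: N.emeasure_space_1 mult_1_right)
      also have "\<dots> = ennreal (1 / h) * (\<integral>\<^sup>+x. (ennreal (norm (G x)))\<^sup>2 * std_normal_density ((x - b) / h) \<partial>lborel)"
        by (rule nn_integral_gauss_shift) (use h in auto)
      finally show ?thesis .
    qed
    \<comment> \<open>Size of the \<open>M\<close>-integral of the Gaussian of width
      \<open>h\<close>, relative to the standard density at \<open>x\<close>; it decays like
      \<open>\<bar>R\<bar> powr - s\<close>.\<close>
    define w where "w = exp (K\<^sup>2) * C0 * (sqrt 2 * h) powr s"
    have w0: "w \<ge> 0" using C0 by (simp add: w_def)
    have inner: "(\<integral>\<^sup>+b. std_normal_density ((x - b) / h) \<partial>M) \<le> ennreal (w * std_normal_density x)" for x
    proof -
      have "(\<integral>\<^sup>+b. std_normal_density ((x - b) / h) \<partial>M)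
          \<le> (\<integral>\<^sup>+b. ennreal (std_normal_density x * exp (K\<^sup>2) * exp (- (1 / (sqrt 2 * h) * (b - x))\<^sup>2 / 2)) \<partial>M)"
      proof (rule nn_integral_mono_AE)
        show "AE b in M. ennreal (std_normal_density ((x - b) / h)) \<le>
          ennreal (std_normal_density x * exp (K\<^sup>2) * exp (- (1 / (sqrt 2 * h) * (b - x))\<^sup>2 / 2))"
          using AE_K
        proof eventually_elim
          case (elim b)
          have "b\<^sup>2 \<le> K\<^sup>2" using elim by (subst abs_le_square_iff[symmetric]) auto
          \<comment> \<open>The exponent \<open>((x - b) / h)\<^sup>2 / 2\<close> is cut into two
            halves. One is kept for the ball estimate; the other is at least
            \<open>(x - b)\<^sup>2\<close> because \<open>h \<le> 1 / 2\<close>, and since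
            \<open>b\<close> is bounded it pays for the standard Gaussian in
            \<open>x\<close>.\<close>
          have "h\<^sup>2 \<le> (1 / 2)\<^sup>2" using h by (intro power_mono) auto
          then have h2: "4 * h\<^sup>2 \<le> 1" by (simp add: power2_eq_square)
          then have "(x - b)\<^sup>2 * 1 \<le> (x - b)\<^sup>2 / (4 * h\<^sup>2)"
            using h mult_left_mono[OF h2, of "(x - b)\<^sup>2"] by (simp add: field_simps)
          moreover have "x\<^sup>2 / 2 \<le> b\<^sup>2 + (x - b)\<^sup>2"
            using zero_le_power2[of "x - 2 * b"] by (simp add: power2_eq_square algebra_simps)
          ultimately have "- ((x - b) / h)\<^sup>2 / 2 \<le> - x\<^sup>2 / 2 + K\<^sup>2 - (x - b)\<^sup>2 / (4 * h\<^sup>2)"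
            using \<open>b\<^sup>2 \<le> K\<^sup>2\<close> by (simp add: power_divide field_simps)
          moreover have "- (1 / (sqrt 2 * h) * (b - x))\<^sup>2 / 2 = - (x - b)\<^sup>2 / (4 * h\<^sup>2)"
            by (simp add: power_mult_distrib power_divide power2_commute)
          ultimately have "exp (- ((x - b) / h)\<^sup>2 / 2) \<le> exp (- x\<^sup>2 / 2) * exp (K\<^sup>2) * exp (- (1 / (sqrt 2 * h) * (b - x))\<^sup>2 / 2)"
            by (simp flip: exp_add)
          then show ?case
            by (auto simp: std_normal_density_def divide_right_mono intro!: ennreal_leI)
        qed
      qed
      also have "\<dots> = ennreal (std_normal_density x * exp (K\<^sup>2)) * (\<integral>\<^sup>+b. ennreal (exp (- (1 / (sqrt 2 * h) * (b - x))\<^sup>2 / 2)) \<partial>M)"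
        by (subst nn_integral_cmult[symmetric]) (auto simp flip: ennreal_mult)
      also have "(\<integral>\<^sup>+b. ennreal (exp (- (1 / (sqrt 2 * h) * (b - x))\<^sup>2 / 2)) \<partial>M)
          = ennreal (\<integral>b. exp (- (1 / (sqrt 2 * h) * (b - x))\<^sup>2 / 2) \<partial>M)"
        by (intro nn_integral_eq_integral integrable_const_bound[where B = 1]) auto
      also have "ennreal (std_normal_density x * exp (K\<^sup>2)) * \<dots>
          \<le> ennreal (std_normal_density x * exp (K\<^sup>2)) * ennreal (C0 * \<bar>1 / (sqrt 2 * h)\<bar> powr - s)"
        using h by (intro mult_left_mono ennreal_leI C0(2)) auto
      also have "\<bar>1 / (sqrt 2 * h)\<bar> powr - s = (sqrt 2 * h) powr s"
        using h by (simp add: powr_divide powr_minus)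
      also have "ennreal (std_normal_density x * exp (K\<^sup>2)) * ennreal (C0 * (sqrt 2 * h) powr s) = ennreal (w * std_normal_density x)"
        using C0 by (simp add: w_def algebra_simps flip: ennreal_mult)
      finally show ?thesis .
    qed
    \<comment> \<open>With the standard weight in place, \<open>G\<close> is an exponential integral
      of frequency \<open>- 2 * R\<close>, so the Gaussian bound applies.\<close>
    have G2: "(\<integral>\<^sup>+x. (ennreal (norm (G x)))\<^sup>2 * std_normal_density x \<partial>lborel) \<le> ennreal (C1 * B\<^sup>2 * \<bar>2 * R\<bar> powr - s)"
    proof -
      have "(\<integral>\<^sup>+x. (ennreal (norm (G x)))\<^sup>2 * std_normal_density x \<partial>lborel) = (\<integral>\<^sup>+x. ennreal ((norm (G x))\<^sup>2) \<partial>gauss)"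
        by (subst nn_integral_density) (auto simp: mult.commute ennreal_power)
      also have "\<dots> = ennreal (\<integral>x. (norm (G x))\<^sup>2 \<partial>gauss)"
        by (intro nn_integral_eq_integral N.integrable_const_bound[where B = "(B * m)\<^sup>2"] AE_I2)
           (auto intro!: power_mono GB)
      also have "\<dots> \<le> ennreal (C1 * B\<^sup>2 * \<bar>2 * R\<bar> powr - s)"
        using C1(2)[of "- 2 * R" g B] R gB by (intro ennreal_leI) (auto simp: G_def)
      finally show ?thesis .
    qed
    have "(\<integral>\<^sup>+b. (ennreal (norm (J b)))\<^sup>2 \<partial>M)
        \<le> (\<integral>\<^sup>+b. ennreal (1 / h) * (\<integral>\<^sup>+x. (ennreal (norm (G x)))\<^sup>2 * std_normal_density ((x - b) / h) \<partial>lborel) \<partial>M)"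
      by (intro nn_integral_mono J_le)
    also have "\<dots> = ennreal (1 / h) * (\<integral>\<^sup>+b. \<integral>\<^sup>+x. (ennreal (norm (G x)))\<^sup>2 * std_normal_density ((x - b) / h) \<partial>lborel \<partial>M)"
      by (rule nn_integral_cmult) measurable
    also have "(\<integral>\<^sup>+b. \<integral>\<^sup>+x. (ennreal (norm (G x)))\<^sup>2 * std_normal_density ((x - b) / h) \<partial>lborel \<partial>M)
        = (\<integral>\<^sup>+x. \<integral>\<^sup>+b. (ennreal (norm (G x)))\<^sup>2 * std_normal_density ((x - b) / h) \<partial>M \<partial>lborel)"
      by (rule LM.Fubini') measurable
    also have "\<dots> = (\<integral>\<^sup>+x. (ennreal (norm (G x)))\<^sup>2 * (\<integral>\<^sup>+b. std_normal_density ((x - b) / h) \<partial>M) \<partial>lborel)"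
      by (intro nn_integral_cong nn_integral_cmult) measurable
    also have "ennreal (1 / h) * \<dots> \<le> ennreal (1 / h) * (\<integral>\<^sup>+x. (ennreal (norm (G x)))\<^sup>2 * ennreal (w * std_normal_density x) \<partial>lborel)"
      by (intro mult_left_mono nn_integral_mono inner) auto
    also have "(\<integral>\<^sup>+x. (ennreal (norm (G x)))\<^sup>2 * ennreal (w * std_normal_density x) \<partial>lborel)
        = ennreal w * (\<integral>\<^sup>+x. (ennreal (norm (G x)))\<^sup>2 * std_normal_density x \<partial>lborel)"
      using w0 by (subst nn_integral_cmult[symmetric]) (auto simp: ennreal_mult mult.left_commute)
    also have "ennreal (1 / h) * (ennreal w * (\<integral>\<^sup>+x. (ennreal (norm (G x)))\<^sup>2 * std_normal_density x \<partial>lborel))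
        \<le> ennreal (1 / h) * (ennreal w * ennreal (C1 * B\<^sup>2 * \<bar>2 * R\<bar> powr - s))"
      by (intro mult_left_mono G2) auto
    also have "\<dots> = ennreal (1 / h * w * (C1 * B\<^sup>2 * \<bar>2 * R\<bar> powr - s))"
      using h w0 C1 by (simp add: ennreal_mult[symmetric] mult.assoc)
    finally have J2: "(\<integral>\<^sup>+b. (ennreal (norm (J b)))\<^sup>2 \<partial>M) \<le> ennreal (1 / h * w * (C1 * B\<^sup>2 * \<bar>2 * R\<bar> powr - s))" .
    have JB: "norm (J b) \<le> m" for b
    proof -
      have "norm (J b) \<le> (\<integral>a. norm (cis (R * (a - b)\<^sup>2)) \<partial>M)"
        unfolding J_def by (rule integral_norm_bound)
      then show ?thesis by (simp add: m_def)
    qed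
    have "(\<integral>p. cis (R * (fst p - snd p)\<^sup>2) \<partial>(M \<Otimes>\<^sub>M M)) = (\<integral>b. J b \<partial>M)"
    proof -
      have "integrable (M \<Otimes>\<^sub>M M) (\<lambda>(a, b). cis (R * (a - b)\<^sup>2))"
        by (rule P.integrable_const_bound[where B = 1]) (auto simp: case_prod_unfold)
      from MM.integral_snd[OF this] show ?thesis
        by (simp add: J_def case_prod_unfold)
    qed
    moreover have "integrable M J"
      by (rule integrable_const_bound[where B = m]) (auto simp: JB)
    ultimately have "(ennreal (norm (\<integral>p. cis (R * (fst p - snd p)\<^sup>2) \<partial>(M \<Otimes>\<^sub>M M))))\<^sup>2
        \<le> (\<integral>\<^sup>+b. (ennreal (norm (J b)))\<^sup>2 \<partial>M) * emeasure M (space M)"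
      by (simp only: ennreal_norm_integral_square_le)
    also have "\<dots> \<le> ennreal (1 / h * w * (C1 * B\<^sup>2 * \<bar>2 * R\<bar> powr - s)) * ennreal m"
      by (intro mult_mono J2) (auto simp: m_def emeasure_eq_measure)
    also have "\<dots> = ennreal (1 / h * w * (C1 * B\<^sup>2 * \<bar>2 * R\<bar> powr - s) * m)"
      using h w0 C1 by (simp add: ennreal_mult[symmetric] m_def)
    finally have "(norm (\<integral>p. cis (R * (fst p - snd p)\<^sup>2) \<partial>(M \<Otimes>\<^sub>M M)))\<^sup>2 \<le> 1 / h * w * (C1 * B\<^sup>2 * \<bar>2 * R\<bar> powr - s) * m"
      using h w0 C1 by (simp add: ennreal_power m_def)
    also have "\<dots> \<le> 1 / h * w * (C1 * B\<^sup>2 * \<bar>2 * R\<bar> powr - s) * (m + 1)"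
      using h w0 C1 by (intro mult_left_mono) auto
    \<comment> \<open>The factor \<open>1 / h\<close> contributes one power of
      \<open>\<bar>R\<bar>\<close>; \<open>w\<close> and the mean square of \<open>G\<close>
      contribute \<open>\<bar>R\<bar> powr - s\<close> each.\<close>
    also have "\<dots> = C * (\<bar>R\<bar> * \<bar>R\<bar> powr - s * \<bar>R\<bar> powr - s)"
      using R by (simp add: C_def w_def h_def powr_mult powr_divide powr_minus abs_mult field_simps)
    also have "\<bar>R\<bar> * \<bar>R\<bar> powr - s * \<bar>R\<bar> powr - s = \<bar>R\<bar> powr 1 * \<bar>R\<bar> powr - s * \<bar>R\<bar> powr - s"
      using R by simp
    also have "\<dots> = \<bar>R\<bar> powr (1 - 2 * s)"
      unfolding powr_add[symmetric] by simp
    finally show ?thesis .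
  qed
  ultimately show ?thesis by blast
qed

subsection \<open>Energy of the set of squared distances\<close>

text \<open>The weight \<open>\<bar>\<xi>\<bar>\<^sup>p\<close> is dominated by a sum of Gaussians at the dyadic scales \<open>2\<^sup>j\<close>.\<close>

lemma weighted_energy_finite:
  fixes f :: "real \<Rightarrow> real"
  assumes sets: "sets T = sets borel" and fin: "finite_measure T" and bb: "ball_bound s T"
    and [measurable]: "f \<in> borel_measurable borel" and f0: "\<And>\<xi>. 0 \<le> f \<xi>"
    and fm: "\<And>\<xi>. f \<xi> \<le> m" and fC: "\<And>\<xi>. \<bar>\<xi>\<bar> \<ge> 1 \<Longrightarrow> f \<xi> \<le> C * \<bar>\<xi>\<bar> powr p" and "p + 1 < s"
  shows "(\<integral>\<^sup>+\<xi>. ennreal (f \<xi> * (norm (\<integral>t. cis (\<xi> * t) \<partial>T))\<^sup>2) \<partial>lborel) < \<infinity>"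
proof -
  note [measurable_cong] = sets
  interpret finite_measure T by (rule fin)
  interpret N: prob_space gauss by (rule prob_space_gauss)
  obtain C1 where "C1 > 0" and "\<forall>R B (g :: real \<Rightarrow> complex). R \<noteq> 0 \<longrightarrow> g \<in> borel_measurable borel \<longrightarrow>
      (\<forall>a. norm (g a) \<le> B) \<longrightarrow>
      (\<integral>x. (norm (\<integral>a. g a * cis (R * a * x) \<partial>T))\<^sup>2 \<partial>gauss) \<le> C1 * B\<^sup>2 * \<bar>R\<bar> powr - s"
    using gauss_L2_le[OF sets fin bb] by blast
  note C1 = this[rule_format]
  define \<tau> where "\<tau> \<xi> = (norm (\<integral>t. cis (\<xi> * t) \<partial>T))\<^sup>2" for \<xi>
  have [measurable]: "\<tau> \<in> borel_measurable borel" unfolding \<tau>_def by measurable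
  have \<tau>0: "\<tau> \<xi> \<ge> 0" for \<xi> by (simp add: \<tau>_def)
  define mT where "mT = measure T (space T)"
  have \<tau>B: "\<tau> \<xi> \<le> mT\<^sup>2" for \<xi>
  proof -
    have "norm (\<integral>t. cis (\<xi> * t) \<partial>T) \<le> (\<integral>t. norm (cis (\<xi> * t)) \<partial>T)"
      by (rule integral_norm_bound)
    then show ?thesis unfolding \<tau>_def by (intro power_mono) (auto simp: mT_def)
  qed
  define n1 where "n1 = std_normal_density 1"
  have n1: "n1 > 0" by (simp add: n1_def normal_density_pos)
  have C: "C \<ge> 0" using fC[of 1] f0[of 1] by simp
  have m: "m \<ge> 0" using f0[of 1] fm[of 1] by simp
  \<comment> \<open>Makes \<open>W * n1\<close> dominate the sup bound, used for
    \<open>\<bar>\<xi>\<bar> < 1\<close>, and the power bound with the loss from rounding to a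
    dyadic scale.\<close>
  define W where "W = (m + C * 2 powr \<bar>p\<bar>) / n1"
  have Wn1: "W * n1 = m + C * 2 powr \<bar>p\<bar>" using n1 by (simp add: W_def)
  have W0: "W \<ge> 0" using m C n1 by (simp add: W_def)
  define w where "w j = W * 2 powr (p * real j)" for j :: nat
  have w0: "w j \<ge> 0" for j using W0 by (simp add: w_def)
  have pt: "ennreal (f \<xi> * \<tau> \<xi>) \<le> (\<Sum>j. ennreal (w j) * (ennreal (\<tau> \<xi>) * std_normal_density ((\<xi> - 0) / 2 ^ j)))"
    (is "_ \<le> (\<Sum>j. ?h j)") for \<xi>
  proof -
    have "\<exists>j::nat. \<bar>\<xi>\<bar> \<le> 2 ^ j \<and> f \<xi> \<le> w j * n1"
    proof (cases "\<bar>\<xi>\<bar> \<ge> 1")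
      case False
      have "m \<le> W * n1" using C n1 by (simp add: W_def)
      then show ?thesis using False fm[of \<xi>] by (intro exI[of _ 0]) (auto simp: w_def)
    next
      case True
      define l where "l = log 2 \<bar>\<xi>\<bar>"
      have l: "l \<ge> 0" "\<bar>\<xi>\<bar> = 2 powr l" using True by (auto simp: l_def)
      \<comment> \<open>Rounding the logarithm up errs by at most 1, so replacing
        \<open>\<bar>\<xi>\<bar>\<close> by \<open>2 ^ j\<close> in the power costs at most
        \<open>2 powr \<bar>p\<bar>\<close>, whatever the sign of \<open>p\<close>.\<close>
      define j where "j = nat \<lceil>l\<rceil>"
      have j: "l \<le> real j" "real j \<le> l + 1" using l(1) unfolding j_def by linarith+
      have "\<bar>\<xi>\<bar> \<le> 2 ^ j" using j(1) by (simp add: l(2) flip: powr_realpow)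
      moreover have "f \<xi> \<le> w j * n1"
      proof -
        have "p * l - p * real j \<le> \<bar>p\<bar>"
        proof -
          have "p * (l - real j) \<le> \<bar>p\<bar> * \<bar>l - real j\<bar>" by (metis abs_ge_self abs_mult)
          also have "\<dots> \<le> \<bar>p\<bar> * 1" using j by (intro mult_left_mono) auto
          finally show ?thesis by (simp add: algebra_simps)
        qed
        then have "\<bar>\<xi>\<bar> powr p \<le> 2 powr \<bar>p\<bar> * 2 powr (p * real j)"
          unfolding l(2) powr_powr powr_add[symmetric] by (intro powr_mono) (auto simp: mult.commute)
        then have "C * \<bar>\<xi>\<bar> powr p \<le> C * (2 powr \<bar>p\<bar> * 2 powr (p * real j))"
          using C by (rule mult_left_mono)
        also have "\<dots> \<le> w j * n1"
        proof -
          have "w j * n1 = (m + C * 2 powr \<bar>p\<bar>) * 2 powr (p * real j)"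
            by (simp add: w_def flip: Wn1)
          then show ?thesis using m by (simp add: algebra_simps)
        qed
        finally show ?thesis using fC[OF True] by linarith
      qed
      ultimately show ?thesis by blast
    qed
    then obtain j :: nat where j: "\<bar>\<xi>\<bar> \<le> 2 ^ j" "f \<xi> \<le> w j * n1" by blast
    have "(\<xi> / 2 ^ j)\<^sup>2 \<le> 1\<^sup>2"
      using j(1) by (subst abs_le_square_iff[symmetric]) (simp add: field_simps)
    then have "n1 \<le> std_normal_density (\<xi> / 2 ^ j)"
      by (simp add: n1_def std_normal_density_def divide_right_mono)
    then have "w j * n1 \<le> w j * std_normal_density (\<xi> / 2 ^ j)"
      using w0 by (rule mult_left_mono)
    then have "f \<xi> * \<tau> \<xi> \<le> w j * std_normal_density (\<xi> / 2 ^ j) * \<tau> \<xi>"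
      using j(2) \<tau>0 by (intro mult_right_mono) auto
    then have "ennreal (f \<xi> * \<tau> \<xi>) \<le> ?h j"
      using w0 \<tau>0 by (simp add: ennreal_mult[symmetric] ennreal_leI ac_simps)
    also have "\<dots> \<le> (\<Sum>j. ?h j)"
      using sum_le_suminf[OF summableI, of "{j}" ?h]
      by (simp only: sum.insert sum.empty finite.emptyI empty_iff not_False_eq_True add_0_right) simp
    finally show ?thesis .
  qed
  \<comment> \<open>Ratio of consecutive scales: the weight gives \<open>2 powr p\<close>, the
    dilation \<open>2\<close>, the mean square of the transform \<open>2 powr - s\<close>. Below 1
    exactly because \<open>p + 1 < s\<close>.\<close>
  define q where "q = 2 powr (p + 1 - s)"
  have q: "0 < q" "q < 1" using \<open>p + 1 < s\<close> powr_less_mono[of "p + 1 - s" 0 2] by (auto simp: q_def)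
  have "(\<integral>\<^sup>+\<xi>. ennreal (f \<xi> * \<tau> \<xi>) \<partial>lborel) \<le>
      (\<integral>\<^sup>+\<xi>. (\<Sum>j. ennreal (w j) * (ennreal (\<tau> \<xi>) * std_normal_density ((\<xi> - 0) / 2 ^ j))) \<partial>lborel)"
    by (intro nn_integral_mono pt)
  also have "\<dots> = (\<Sum>j. \<integral>\<^sup>+\<xi>. ennreal (w j) * (ennreal (\<tau> \<xi>) * std_normal_density ((\<xi> - 0) / 2 ^ j)) \<partial>lborel)"
    by (rule nn_integral_suminf) measurable
  also have "\<dots> \<le> (\<Sum>j. ennreal (W * C1 * q ^ j))"
  proof (intro suminf_le summableI)
    fix j :: nat
    have "(\<integral>\<^sup>+\<xi>. ennreal (\<tau> \<xi>) * std_normal_density ((\<xi> - 0) / 2 ^ j) \<partial>lborel)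
        = ennreal (2 ^ j) * (ennreal (1 / 2 ^ j) * (\<integral>\<^sup>+\<xi>. ennreal (\<tau> \<xi>) * std_normal_density ((\<xi> - 0) / 2 ^ j) \<partial>lborel))"
      by (simp add: mult.assoc[symmetric] flip: ennreal_mult)
    also have "ennreal (1 / 2 ^ j) * (\<integral>\<^sup>+\<xi>. ennreal (\<tau> \<xi>) * std_normal_density ((\<xi> - 0) / 2 ^ j) \<partial>lborel)
        = (\<integral>\<^sup>+x. ennreal (\<tau> (0 + 2 ^ j * x)) \<partial>gauss)"
      by (rule nn_integral_gauss_shift[symmetric]) auto
    also have "\<dots> = ennreal (\<integral>x. \<tau> (2 ^ j * x) \<partial>gauss)"
      by (subst nn_integral_eq_integral[symmetric])
         (auto intro!: N.integrable_const_bound[where B = "mT\<^sup>2"] simp: \<tau>0 \<tau>B)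
    also have "(\<integral>x. \<tau> (2 ^ j * x) \<partial>gauss) \<le> C1 * (2 ^ j) powr - s"
      using C1(2)[of "2 ^ j" "\<lambda>_. 1" 1] by (simp add: \<tau>_def ac_simps)
    finally have "(\<integral>\<^sup>+\<xi>. ennreal (\<tau> \<xi>) * std_normal_density ((\<xi> - 0) / 2 ^ j) \<partial>lborel)
        \<le> ennreal (2 ^ j) * ennreal (C1 * (2 ^ j) powr - s)"
      by (simp add: ennreal_leI mult_left_mono)
    then have "(\<integral>\<^sup>+\<xi>. ennreal (w j) * (ennreal (\<tau> \<xi>) * std_normal_density ((\<xi> - 0) / 2 ^ j)) \<partial>lborel)
        \<le> ennreal (w j) * (ennreal (2 ^ j) * ennreal (C1 * (2 ^ j) powr - s))"
      by (subst nn_integral_cmult) (auto intro: mult_left_mono)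
    also have "\<dots> = ennreal (w j * 2 ^ j * (C1 * (2 ^ j) powr - s))"
      using w0 C1(1) by (simp add: ennreal_mult[symmetric] mult.assoc)
    also have "w j * 2 ^ j * (C1 * (2 ^ j) powr - s) = W * C1 * q ^ j"
    proof -
      have "2 powr (p * real j) * 2 powr real j * (2 powr real j) powr - s = (2 powr (p + 1 - s)) powr real j"
        unfolding powr_powr powr_add[symmetric] by (simp add: algebra_simps)
      then show ?thesis by (simp add: w_def q_def powr_realpow)
    qed
    finally show "(\<integral>\<^sup>+\<xi>. ennreal (w j) * (ennreal (\<tau> \<xi>) * std_normal_density ((\<xi> - 0) / 2 ^ j)) \<partial>lborel)
        \<le> ennreal (W * C1 * q ^ j)" .
  qed
  also have "\<dots> < \<infinity>"
  proof -
    have "summable (\<lambda>j. W * C1 * q ^ j)"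
      using q by (intro summable_mult summable_geometric) simp
    then have "(\<Sum>j. ennreal (W * C1 * q ^ j)) \<noteq> top"
      by (rule ennreal_suminf_neq_top) (use W0 C1(1) q in simp)
    then show ?thesis by (simp only: infinity_ennreal_def less_top)
  qed
  finally show ?thesis by (simp add: \<tau>_def)
qed

text \<open>The transform of \<open>S\<close> is a product of two transforms and is square
  integrable. The energy at scale \<open>\<delta>\<close> is controlled by a Gaussian average of its
  squared norm over frequencies of order \<open>1 / \<delta>\<close>, hence by
  \<open>\<delta>\<close> times its total integral.\<close>

lemma square_sum_energy_le:
  assumes setsM: "sets M = sets borel" and finM: "finite_measure M" and bbM: "ball_bound s M"
    and supp: "emeasure M (- {-K..K}) = 0"
    and setsT: "sets T = sets borel" and finT: "finite_measure T" and bbT: "ball_bound t T"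
    and st: "2 * s + t > 2"
    and S_def: "S = distr ((M \<Otimes>\<^sub>M M) \<Otimes>\<^sub>M T) borel (\<lambda>(p, u). (fst p - snd p)\<^sup>2 + u)"
  shows "\<exists>C. \<forall>\<delta>>0. (\<integral>\<^sup>+y. emeasure S (cball y \<delta>) \<partial>S) \<le> ennreal (C * \<delta>)"
proof -
  note [measurable_cong] = setsM setsT
  interpret M: finite_measure M by (rule finM)
  interpret T: finite_measure T by (rule finT)
  interpret N: prob_space gauss by (rule prob_space_gauss)
  have finMM: "finite_measure (M \<Otimes>\<^sub>M M)" by (rule finite_measure_pair_measure[OF finM finM])
  interpret MM: finite_measure "M \<Otimes>\<^sub>M M" by (rule finMM)
  have finP: "finite_measure ((M \<Otimes>\<^sub>M M) \<Otimes>\<^sub>M T)" by (rule finite_measure_pair_measure[OF finT finMM])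
  interpret P: finite_measure "(M \<Otimes>\<^sub>M M) \<Otimes>\<^sub>M T" by (rule finP)
  interpret PT: pair_sigma_finite "M \<Otimes>\<^sub>M M" T ..
  have setsS: "sets S = sets borel" by (simp add: S_def)
  note [measurable_cong] = setsS
  have finS: "finite_measure S" unfolding S_def by (intro P.finite_measure_distr) measurable
  interpret S: finite_measure S by (rule finS)
  interpret SS: pair_sigma_finite S S ..
  interpret SSf: finite_measure "S \<Otimes>\<^sub>M S" by (rule finite_measure_pair_measure[OF finS finS])
  obtain C where "C > 0" and "\<forall>R. \<bar>R\<bar> \<ge> 1 \<longrightarrow>
      (norm (\<integral>p. cis (R * (fst p - snd p)\<^sup>2) \<partial>(M \<Otimes>\<^sub>M M)))\<^sup>2 \<le> C * \<bar>R\<bar> powr (1 - 2 * s)"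
    using quadratic_phase_decay[OF setsM finM bbM supp] by blast
  note C = this[rule_format]
  define \<nu> where "\<nu> \<xi> = (\<integral>p. cis (\<xi> * (fst p - snd p)\<^sup>2) \<partial>(M \<Otimes>\<^sub>M M))" for \<xi>
  have [measurable]: "\<nu> \<in> borel_measurable borel" unfolding \<nu>_def by measurable
  define \<tau> where "\<tau> \<xi> = (\<integral>u. cis (\<xi> * u) \<partial>T)" for \<xi>
  have [measurable]: "\<tau> \<in> borel_measurable borel" unfolding \<tau>_def by measurable
  have S_hat: "(\<integral>z. cis (\<xi> * z) \<partial>S) = \<nu> \<xi> * \<tau> \<xi>" for \<xi>
  proof -
    have "(\<integral>z. cis (\<xi> * z) \<partial>S) = (\<integral>x. (case x of (p, u) \<Rightarrow> cis (\<xi> * (fst p - snd p)\<^sup>2) * cis (\<xi> * u)) \<partial>((M \<Otimes>\<^sub>M M) \<Otimes>\<^sub>M T))"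
      unfolding S_def
      by (subst integral_distr) (auto simp: cis_mult algebra_simps case_prod_unfold)
    also have "\<dots> = (\<integral>p. \<integral>u. cis (\<xi> * (fst p - snd p)\<^sup>2) * cis (\<xi> * u) \<partial>T \<partial>(M \<Otimes>\<^sub>M M))"
      by (rule PT.integral_fst[symmetric], rule P.integrable_const_bound[where B = 1])
         (auto simp: case_prod_unfold norm_mult)
    also have "\<dots> = \<nu> \<xi> * \<tau> \<xi>"
      by (simp add: \<nu>_def \<tau>_def)
    finally show ?thesis .
  qed
  define \<phi> where "\<phi> \<xi> = (norm (\<nu> \<xi>))\<^sup>2 * (norm (\<tau> \<xi>))\<^sup>2" for \<xi>
  have [measurable]: "\<phi> \<in> borel_measurable borel" unfolding \<phi>_def by measurable
  have \<phi>0: "\<phi> \<xi> \<ge> 0" for \<xi> by (simp add: \<phi>_def)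
  have \<nu>B: "(norm (\<nu> \<xi>))\<^sup>2 \<le> (measure (M \<Otimes>\<^sub>M M) (space (M \<Otimes>\<^sub>M M)))\<^sup>2" for \<xi>
  proof -
    have "norm (\<nu> \<xi>) \<le> (\<integral>p. norm (cis (\<xi> * (fst p - snd p)\<^sup>2)) \<partial>(M \<Otimes>\<^sub>M M))"
      unfolding \<nu>_def by (rule integral_norm_bound)
    then show ?thesis by (intro power_mono) auto
  qed
  \<comment> \<open>Here the power is \<open>p = 1 - 2 * s\<close> and the ball exponent is
    \<open>t\<close>, so \<open>p + 1 < t\<close> is exactly \<open>2 * s + t > 2\<close>.\<close>
  have "(\<integral>\<^sup>+\<xi>. ennreal (\<phi> \<xi>) \<partial>lborel) < \<infinity>"
    unfolding \<phi>_def \<tau>_def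
    by (rule weighted_energy_finite[OF setsT finT bbT _ _ \<nu>B C(2)[folded \<nu>_def]]) (use st in auto)
  then obtain I where I: "(\<integral>\<^sup>+\<xi>. ennreal (\<phi> \<xi>) \<partial>lborel) = ennreal I" "I \<ge> 0"
    by (cases "\<integral>\<^sup>+\<xi>. ennreal (\<phi> \<xi>) \<partial>lborel") auto
  have "(\<integral>\<^sup>+y. emeasure S (cball y \<delta>) \<partial>S) \<le> ennreal (exp (1 / 2) * I * \<delta>)" if \<delta>: "\<delta> > 0" for \<delta>
  proof -
    define E where "E p = exp (- (1 / \<delta> * (fst p - snd p))\<^sup>2 / 2)" for p :: "real \<times> real"
    have [measurable]: "E \<in> borel_measurable (S \<Otimes>\<^sub>M S)" unfolding E_def by measurable
    have E0: "E p \<ge> 0" for p by (simp add: E_def)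
    have E_eq: "(\<integral>p. E p \<partial>(S \<Otimes>\<^sub>M S)) = (\<integral>x. \<phi> (1 / \<delta> * x) \<partial>gauss)"
    proof -
      have G: "(\<integral>a. 1 * cis (1 / \<delta> * a * x) \<partial>S) = \<nu> (1 / \<delta> * x) * \<tau> (1 / \<delta> * x)" for x
        using S_hat[of "1 / \<delta> * x"] by (simp add: ac_simps)
      have "complex_of_real (\<integral>x. (norm (\<integral>a. 1 * cis (1 / \<delta> * a * x) \<partial>S))\<^sup>2 \<partial>gauss)
          = (\<integral>p. 1 * cnj 1 * of_real (exp (- (1 / \<delta> * (fst p - snd p))\<^sup>2 / 2)) \<partial>(S \<Otimes>\<^sub>M S))"
        by (rule gauss_L2_eq[OF setsS finS, where B = 1]) auto
      also have "\<dots> = complex_of_real (\<integral>p. E p \<partial>(S \<Otimes>\<^sub>M S))"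
        by (simp add: E_def)
      finally have "(\<integral>x. (norm (\<integral>a. 1 * cis (1 / \<delta> * a * x) \<partial>S))\<^sup>2 \<partial>gauss) = (\<integral>p. E p \<partial>(S \<Otimes>\<^sub>M S))"
        by (simp only: of_real_eq_iff)
      then show ?thesis
        by (simp only: G \<phi>_def norm_mult power_mult_distrib)
    qed
    have "(\<integral>\<^sup>+y. \<integral>\<^sup>+a. ennreal (E (y, a)) \<partial>S \<partial>S) = (\<integral>\<^sup>+p. ennreal (E p) \<partial>(S \<Otimes>\<^sub>M S))"
      by (rule S.nn_integral_fst) measurable
    also have "\<dots> = ennreal (\<integral>p. E p \<partial>(S \<Otimes>\<^sub>M S))"
      by (intro nn_integral_eq_integral SSf.integrable_const_bound[where B = 1]) (auto simp: E_def)
    also have "\<dots> = ennreal (enn2real (\<integral>\<^sup>+x. ennreal (\<phi> (1 / \<delta> * x)) \<partial>gauss))"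
      unfolding E_eq by (subst integral_eq_nn_integral) (auto simp: \<phi>0)
    \<comment> \<open>\<open>enn2real\<close> could only lower the value, by sending infinity to 0,
      and an upper bound is wanted.\<close>
    also have "\<dots> \<le> (\<integral>\<^sup>+x. ennreal (\<phi> (1 / \<delta> * x)) \<partial>gauss)"
      by (simp only: ennreal_enn2real_if) simp
    also have "\<dots> = (\<integral>\<^sup>+x. ennreal (\<phi> (0 + 1 / \<delta> * x)) \<partial>gauss)" by simp
    also have "\<dots> = ennreal (1 / (1 / \<delta>)) * (\<integral>\<^sup>+x. ennreal (\<phi> x) * std_normal_density ((x - 0) / (1 / \<delta>)) \<partial>lborel)"
      by (rule nn_integral_gauss_shift) (use \<delta> in auto)
    \<comment> \<open>The Gaussian density is at most \<open>1\<close>; the gain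
      \<open>\<delta>\<close> comes from the substitution alone.\<close>
    also have "\<dots> \<le> ennreal (1 / (1 / \<delta>)) * (\<integral>\<^sup>+x. ennreal (\<phi> x) * 1 \<partial>lborel)"
    proof (intro mult_left_mono nn_integral_mono)
      fix x
      have "exp (- (x * \<delta>)\<^sup>2 / 2) \<le> 1" by simp
      also have "1 \<le> sqrt (2 * pi)" using pi_gt3 by (subst real_le_rsqrt) auto
      finally show "ennreal (std_normal_density ((x - 0) / (1 / \<delta>))) \<le> 1"
        by (simp add: std_normal_density_def)
    qed auto
    also have "\<dots> = ennreal (I * \<delta>)"
      using \<delta> I by (simp add: ennreal_mult mult.commute)
    finally have EI: "(\<integral>\<^sup>+y. \<integral>\<^sup>+a. ennreal (E (y, a)) \<partial>S \<partial>S) \<le> ennreal (I * \<delta>)" .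
    have "(\<integral>\<^sup>+y. emeasure S (cball y \<delta>) \<partial>S) = (\<integral>\<^sup>+y. \<integral>\<^sup>+a. indicator (cball y \<delta>) a \<partial>S \<partial>S)"
      by (simp add: setsS)
    \<comment> \<open>On the ball the Gaussian exponent is at least \<open>- 1 / 2\<close>.\<close>
    also have "\<dots> \<le> (\<integral>\<^sup>+y. \<integral>\<^sup>+a. ennreal (exp (1 / 2)) * ennreal (E (y, a)) \<partial>S \<partial>S)"
    proof (intro nn_integral_mono)
      fix y a :: real
      show "indicator (cball y \<delta>) a \<le> ennreal (exp (1 / 2)) * ennreal (E (y, a))"
      proof (cases "a \<in> cball y \<delta>")
        case True
        then have "(1 / \<delta> * (y - a))\<^sup>2 \<le> 1\<^sup>2"
          using \<delta> by (subst abs_le_square_iff[symmetric]) (simp add: dist_real_def abs_mult)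
        then have "1 \<le> exp (1 / 2) * E (y, a)"
          by (simp add: E_def flip: exp_add)
        then show ?thesis using True E0 by (simp flip: ennreal_mult)
      qed simp
    qed
    also have "\<dots> = (\<integral>\<^sup>+y. ennreal (exp (1 / 2)) * (\<integral>\<^sup>+a. ennreal (E (y, a)) \<partial>S) \<partial>S)"
      by (intro nn_integral_cong nn_integral_cmult) measurable
    also have "\<dots> = ennreal (exp (1 / 2)) * (\<integral>\<^sup>+y. \<integral>\<^sup>+a. ennreal (E (y, a)) \<partial>S \<partial>S)"
      by (rule nn_integral_cmult) measurable
    also have "\<dots> \<le> ennreal (exp (1 / 2)) * ennreal (I * \<delta>)"
      by (intro mult_left_mono EI) simp
    also have "\<dots> = ennreal (exp (1 / 2) * I * \<delta>)"
      using \<delta> I(2) by (simp add: ennreal_mult[symmetric] mult.assoc)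
    finally show ?thesis .
  qed
  then show ?thesis by blast
qed

subsection \<open>Distance sets of products\<close>

lemma emeasure_subset_null:
  assumes "sets M = sets borel" "emeasure M (- X) = 0" "X \<in> sets borel"
  shows "emeasure M X = emeasure M UNIV"
proof -
  have "emeasure M (X \<union> - X) = emeasure M X"
    using assms by (intro emeasure_Un_null_set) (auto simp: null_sets_def)
  then show ?thesis by simp
qed

text \<open>The pin is \<open>b\<^sub>0 = Inf B\<close>; discarding a neighbourhood of it makes \<open>b \<mapsto> (b - b\<^sub>0)\<^sup>2\<close> bi-Lipschitz.
  For \<open>s = 0\<close> the measure may be an atom at \<open>b\<^sub>0\<close>, so a Dirac measure is used instead.\<close>

lemma pinned_square_measure:
  fixes B :: "real set"
  assumes B: "compact B" and s: "s \<ge> 0" and H: "hausdorff_measure s B > 0"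
  obtains T b0 where "sets T = sets borel" "finite_measure T" "measure T UNIV > 0" "b0 \<in> B"
    "emeasure T (- ((\<lambda>b. (b - b0)\<^sup>2) ` B)) = 0" "ball_bound s T"
proof (cases "s = 0")
  case True
  have "B \<noteq> {}" using H by (auto simp: hausdorff_measure_empty)
  then obtain b0 where b0: "b0 \<in> B" by blast
  define T where "T = return borel (0 :: real)"
  interpret T: prob_space T unfolding T_def by (rule prob_space_return) simp
  have "compact ((\<lambda>b. (b - b0)\<^sup>2) ` B)"
    using B by (intro compact_continuous_image continuous_intros)
  then have "(\<lambda>b. (b - b0)\<^sup>2) ` B \<in> sets borel" by (rule borel_compact)
  moreover have "0 \<in> (\<lambda>b. (b - b0)\<^sup>2) ` B" using b0 by force
  ultimately have "emeasure T (- ((\<lambda>b. (b - b0)\<^sup>2) ` B)) = 0"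
    by (simp add: T_def)
  moreover have "ball_bound s T"
    unfolding ball_bound_def by (intro exI[of _ 1]) (auto simp: True)
  moreover have "measure T UNIV > 0"
    using T.prob_space by (simp add: T_def)
  ultimately show ?thesis
    using that[of T b0] b0 T.finite_measure_axioms by (simp add: T_def)
next
  case False
  then have s: "s > 0" using s by simp
  obtain M where sets: "sets M = sets borel" and fin: "finite_measure M" and pos: "measure M UNIV > 0"
    and null: "emeasure M (- B) = 0" and bb: "ball_bound s M"
    using frostman_real[OF B s H] by blast
  note [measurable_cong] = sets
  interpret finite_measure M by (rule fin)
  have spM: "space M = UNIV" using sets_eq_imp_space_eq[OF sets] by simp
  obtain C where C: "C > 0" "\<And>x r. r > 0 \<Longrightarrow> measure M (cball x r) \<le> C * r powr s"
    using bb by (auto simp: ball_bound_def)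
  have "B \<noteq> {}" using null pos by (auto simp: measure_def)
  define b0 where "b0 = Inf B"
  have bdd: "bdd_below B" using B by (simp add: bounded_imp_bdd_below compact_imp_bounded)
  have b0: "b0 \<in> B"
    unfolding b0_def using \<open>B \<noteq> {}\<close> bdd B by (intro closed_contains_Inf compact_imp_closed)
  have b0_le: "b0 \<le> b" if "b \<in> B" for b
    unfolding b0_def by (rule cInf_lower[OF that bdd])
  define \<mu> where "\<mu> = measure M UNIV"
  \<comment> \<open>Solves \<open>C * c powr s = \<mu> / 2\<close>, so the ball removed about
    \<open>b0\<close> holds at most half of the mass.\<close>
  define c where "c = (\<mu> / (2 * C)) powr (1 / s)"
  have c: "c > 0" using pos C(1) by (simp add: c_def \<mu>_def)
  have "C * c powr s = \<mu> / 2"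
    using pos C(1) s by (simp add: c_def \<mu>_def powr_powr)
  then have near: "measure M (cball b0 c) \<le> \<mu> / 2" using C(2)[OF c] by metis
  define X where "X = {b0 + c<..}"
  have [measurable]: "X \<in> sets borel" by (simp add: X_def)
  have Xpos: "measure M X > 0"
  proof -
    have "emeasure M B = emeasure M UNIV"
      using sets null B by (intro emeasure_subset_null borel_compact)
    then have "\<mu> = measure M B" by (simp add: \<mu>_def measure_def)
    also have "\<dots> \<le> measure M (X \<union> cball b0 c)"
    proof (rule finite_measure_mono)
      show "B \<subseteq> X \<union> cball b0 c"
        using b0_le by (force simp: X_def dist_real_def)
    qed (simp add: sets)
    also have "\<dots> \<le> measure M X + measure M (cball b0 c)"
      by (rule measure_Un_le) (simp_all add: sets)
    finally show ?thesis using near pos by (simp add: \<mu>_def)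
  qed
  define f where "f b = (b - b0)\<^sup>2" for b
  have [measurable]: "f \<in> borel_measurable borel" unfolding f_def by measurable
  define T where "T = distr (density M (indicator X)) borel f"
  have T_eq: "emeasure T Y = emeasure M (X \<inter> f -` Y)" if [measurable]: "Y \<in> sets borel" for Y
  proof -
    have m: "f -` Y \<in> sets M"
      using measurable_sets[of f borel borel Y] sets by simp
    have "emeasure T Y = emeasure (density M (indicator X)) (f -` Y)"
      unfolding T_def by (subst emeasure_distr) (auto simp: spM)
    also have "\<dots> = emeasure M (X \<inter> f -` Y)"
      using m by (subst emeasure_restricted) (auto simp: sets)
    finally show ?thesis .
  qed
  have finT: "finite_measure T"
    by (rule finite_measureI) (simp add: T_def[THEN arg_cong[where f = space]] T_eq)
  have setsT: "sets T = sets borel" by (simp add: T_def)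
  have posT: "measure T UNIV > 0"
    using T_eq[of UNIV] Xpos by (simp add: measure_def)
  have nullT: "emeasure T (- (f ` B)) = 0"
  proof -
    have "compact (f ` B)"
      unfolding f_def using B by (intro compact_continuous_image continuous_intros)
    then have "- (f ` B) \<in> sets borel" by (intro borel_comp borel_compact)
    then have "emeasure T (- (f ` B)) = emeasure M (X \<inter> f -` (- (f ` B)))" by (rule T_eq)
    also have "\<dots> \<le> emeasure M (- B)"
      using B by (intro emeasure_mono) (auto simp: sets borel_comp borel_compact)
    finally show ?thesis using null by simp
  qed
  have "measure T (cball x r) \<le> (C / c powr s) * r powr s" if r: "r > 0" for x r
  proof (cases "X \<inter> f -` cball x r = {}")
    case True
    then show ?thesis using T_eq[of "cball x r"] C(1) by (simp add: measure_def)
  next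
    case False
    then obtain b where b: "b \<in> X" "f b \<in> cball x r" by blast
    \<comment> \<open>Two such points have \<open>f\<close>-values within \<open>2 * r\<close>, and
      this difference is \<open>b - b'\<close> times a factor of size at least \<open>2 * c\<close>,
      since both points exceed \<open>b0 + c\<close>.\<close>
    have "X \<inter> f -` cball x r \<subseteq> cball b (r / c)"
    proof
      fix b' assume b': "b' \<in> X \<inter> f -` cball x r"
      have "\<bar>f b - f b'\<bar> \<le> 2 * r"
        using b(2) b' by (auto simp: dist_real_def)
      also have "f b - f b' = (b - b') * (b + b' - 2 * b0)"
        by (simp add: f_def power2_eq_square algebra_simps)
      finally have "\<bar>b - b'\<bar> * \<bar>b + b' - 2 * b0\<bar> \<le> 2 * r" by (simp add: abs_mult)
      moreover have "b0 + c < b" "b0 + c < b'" using b(1) b' by (auto simp: X_def)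
      then have "2 * c \<le> \<bar>b + b' - 2 * b0\<bar>" by linarith
      then have "\<bar>b - b'\<bar> * (2 * c) \<le> \<bar>b - b'\<bar> * \<bar>b + b' - 2 * b0\<bar>"
        by (rule mult_left_mono) simp
      ultimately have "\<bar>b - b'\<bar> * c \<le> r" by simp
      then show "b' \<in> cball b (r / c)" using c by (simp add: dist_real_def pos_le_divide_eq)
    qed
    then have "emeasure T (cball x r) \<le> emeasure M (cball b (r / c))"
      by (subst T_eq) (auto intro!: emeasure_mono simp: sets)
    then have "measure T (cball x r) \<le> measure M (cball b (r / c))"
      using enn2real_mono by (auto simp: measure_def less_top[symmetric] emeasure_finite)
    also have "\<dots> \<le> C * (r / c) powr s" using C(2) r c by simp
    finally show ?thesis using r c by (simp add: powr_divide)
  qed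
  moreover have "C / c powr s > 0" using C(1) c by simp
  ultimately have "ball_bound s T" unfolding ball_bound_def by blast
  then show ?thesis
    using that[OF setsT finT posT b0] nullT by (simp add: f_def)
qed

text \<open>The image measure \<open>S\<close> is carried by a compact set \<open>D\<close> of
  squared distances between points of \<open>A \<times> B\<close>, one of them at height
  \<open>b0\<close>. Its linear energy bound gives \<open>D\<close> positive length, and this passes
  back to the distances.\<close>

lemma pos_distance_set_Times:
  fixes A B :: "real set"
  assumes A: "compact A" and B: "compact B" and s: "s > 0" "t \<ge> 0"
    and HA: "hausdorff_measure s A > 0" and HB: "hausdorff_measure t B > 0"
    and st: "2 * s + t > 2"
  shows "emeasure lebesgue (distance_set (A \<times> B)) > 0"
proof -
  obtain M where setsM: "sets M = sets borel" and finM: "finite_measure M" and posM: "measure M UNIV > 0"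
    and nullM: "emeasure M (- A) = 0" and bbM: "ball_bound s M"
    using frostman_real[OF A s(1) HA] by blast
  obtain T b0 where setsT: "sets T = sets borel" and finT: "finite_measure T" and posT: "measure T UNIV > 0"
    and b0: "b0 \<in> B" and nullT: "emeasure T (- ((\<lambda>b. (b - b0)\<^sup>2) ` B)) = 0" and bbT: "ball_bound t T"
    using pinned_square_measure[OF B s(2) HB] by blast
  note [measurable_cong] = setsM setsT
  define B' where "B' = (\<lambda>b. (b - b0)\<^sup>2) ` B"
  have B': "compact B'" unfolding B'_def using B by (intro compact_continuous_image continuous_intros)
  interpret M: finite_measure M by (rule finM)
  interpret T: finite_measure T by (rule finT)
  have finMM: "finite_measure (M \<Otimes>\<^sub>M M)" by (rule finite_measure_pair_measure[OF finM finM])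
  interpret MM: finite_measure "M \<Otimes>\<^sub>M M" by (rule finMM)
  have finP: "finite_measure ((M \<Otimes>\<^sub>M M) \<Otimes>\<^sub>M T)" by (rule finite_measure_pair_measure[OF finT finMM])
  interpret P: finite_measure "(M \<Otimes>\<^sub>M M) \<Otimes>\<^sub>M T" by (rule finP)
  have sp: "space M = UNIV" "space T = UNIV"
    using sets_eq_imp_space_eq[OF setsM] sets_eq_imp_space_eq[OF setsT] by simp_all
  define F where "F = (\<lambda>(p :: real \<times> real, u :: real). (fst p - snd p)\<^sup>2 + u)"
  have Fm: "F \<in> borel_measurable ((M \<Otimes>\<^sub>M M) \<Otimes>\<^sub>M T)" unfolding F_def by measurable
  define S where "S = distr ((M \<Otimes>\<^sub>M M) \<Otimes>\<^sub>M T) borel F"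
  have setsS: "sets S = sets borel" by (simp add: S_def)
  have finS: "finite_measure S" unfolding S_def by (rule P.finite_measure_distr[OF Fm])
  interpret S: finite_measure S by (rule finS)
  define D where "D = F ` ((A \<times> A) \<times> B')"
  have D: "compact D"
    unfolding D_def F_def case_prod_beta
    using A B' by (intro compact_continuous_image compact_Times continuous_intros)
  have S_UNIV: "emeasure S UNIV = emeasure M UNIV * emeasure M UNIV * emeasure T UNIV"
  proof -
    have "emeasure S UNIV = emeasure ((M \<Otimes>\<^sub>M M) \<Otimes>\<^sub>M T) ((UNIV \<times> UNIV) \<times> UNIV)"
      unfolding S_def by (subst emeasure_distr[OF Fm]) (simp_all add: space_pair_measure sp)
    also have "\<dots> = emeasure M UNIV * emeasure M UNIV * emeasure T UNIV"
      by (simp add: T.emeasure_pair_measure_Times M.emeasure_pair_measure_Times setsM setsT pair_measureI del: UNIV_Times_UNIV)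
    finally show ?thesis .
  qed
  have S_null: "emeasure S (- D) = 0"
  proof -
    have AB: "A \<in> sets borel" "B' \<in> sets borel" using A B' by (auto intro: borel_compact)
    \<comment> \<open>The total mass is finite, so it suffices that \<open>D\<close> carries all of
      it; the factors are carried by \<open>A\<close>, \<open>A\<close> and
      \<open>B'\<close>.\<close>
    have "emeasure S UNIV = emeasure ((M \<Otimes>\<^sub>M M) \<Otimes>\<^sub>M T) ((A \<times> A) \<times> B')"
      using AB nullM nullT emeasure_subset_null[OF setsM nullM] emeasure_subset_null[OF setsT, of B']
      by (simp add: S_UNIV T.emeasure_pair_measure_Times M.emeasure_pair_measure_Times setsM setsT pair_measureI B'_def)
    also have "\<dots> \<le> emeasure ((M \<Otimes>\<^sub>M M) \<Otimes>\<^sub>M T) (F -` D \<inter> space ((M \<Otimes>\<^sub>M M) \<Otimes>\<^sub>M T))"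
      using D by (intro emeasure_mono measurable_sets[OF Fm])
        (auto simp: D_def space_pair_measure sp borel_compact)
    also have "\<dots> = emeasure S D"
      unfolding S_def using D by (subst emeasure_distr[OF Fm]) (auto simp: borel_compact)
    finally have "emeasure S UNIV \<le> emeasure S D" .
    moreover have "emeasure S (- D) = emeasure S UNIV - emeasure S D"
      using emeasure_compl[of D S] D S.emeasure_finite[of D] sets_eq_imp_space_eq[OF setsS]
      by (simp add: setsS borel_compact Compl_eq_Diff_UNIV)
    ultimately show ?thesis by (simp add: diff_eq_0_iff_ennreal S.emeasure_finite less_top[symmetric])
  qed
  have S_pos: "measure S UNIV > 0"
    using posM posT by (simp add: measure_def S_UNIV enn2real_mult)
  obtain K where K: "A \<subseteq> {-K..K}"
  proof -
    obtain k where "\<forall>x\<in>A. \<bar>x\<bar> \<le> k" using compact_imp_bounded[OF A] bounded_real by metis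
    then have "A \<subseteq> {-k..k}" by (auto simp: abs_le_iff)
    then show ?thesis by (rule that)
  qed
  have supp: "emeasure M (- {-K..K}) = 0"
  proof -
    have "emeasure M (- {-K..K}) \<le> emeasure M (- A)"
      using K A by (intro emeasure_mono) (auto simp: setsM borel_comp borel_compact)
    then show ?thesis using nullM by simp
  qed
  obtain C where "\<forall>\<delta>>0. (\<integral>\<^sup>+y. emeasure S (cball y \<delta>) \<partial>S) \<le> ennreal (C * \<delta>)"
    using square_sum_energy_le[OF setsM finM bbM supp setsT finT bbT st S_def[unfolded F_def]] by blast
  then have Dpos: "emeasure lborel D > 0"
    using pos_lborel_of_energy_bound[OF D setsS finS S_pos S_null] by blast
  define \<Delta> where "\<Delta> = distance_set (A \<times> B)"
  have "\<Delta> = (\<lambda>(x, y). dist x y) ` ((A \<times> B) \<times> (A \<times> B))"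
    by (force simp: \<Delta>_def distance_set_def)
  also have "compact \<dots>"
    unfolding case_prod_beta using A B by (intro compact_continuous_image compact_Times continuous_intros)
  finally have \<Delta>: "compact \<Delta>" .
  have D_sub: "D \<subseteq> (\<lambda>x. x\<^sup>2) ` \<Delta>"
  proof
    fix z assume "z \<in> D"
    then obtain a a' b where z: "z = (a - a')\<^sup>2 + (b - b0)\<^sup>2" "a \<in> A" "a' \<in> A" "b \<in> B"
      by (auto simp: D_def F_def B'_def)
    have "z = (dist (a, b) (a', b0))\<^sup>2"
      by (simp add: z(1) dist_Pair_Pair dist_real_def)
    moreover have "dist (a, b) (a', b0) \<in> \<Delta>"
      unfolding \<Delta>_def distance_set_def using z b0 by blast
    ultimately show "z \<in> (\<lambda>x. x\<^sup>2) ` \<Delta>" by blast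
  qed
  show ?thesis
  proof (rule ccontr)
    assume "\<not> emeasure lebesgue (distance_set (A \<times> B)) > 0"
    then have "negligible \<Delta>"
      using \<Delta> by (auto simp: negligible_iff_null_sets null_sets_def \<Delta>_def[symmetric] borel_compact)
    \<comment> \<open>Squaring is differentiable and so preserves negligible sets.\<close>
    then have "negligible ((\<lambda>x. x\<^sup>2) ` \<Delta>)"
      by (rule negligible_differentiable_image_negligible[OF order_refl])
         (auto intro!: derivative_intros simp: differentiable_on_def)
    then have "negligible D" using D_sub by (rule negligible_subset)
    then have "emeasure lebesgue D = 0"
      by (simp add: negligible_iff_null_sets null_sets_def)
    then show False using Dpos D by (simp add: borel_compact)
  qed
qed

lemma distance_set_swap: "distance_set (A \<times> B) = distance_set (B \<times> A)"
  unfolding distance_set_def by (force simp: dist_Pair_Pair add.commute)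

text \<open>Below the dimension the Hausdorff measure is positive, and the strict inequality leaves
  room to lower both exponents.\<close>

lemma pos_distance_set_of_dim:
  fixes A B :: "real set"
  assumes A: "compact A" and B: "compact B"
    and "B \<noteq> {}"
    and less: "hausdorff_dim B < hausdorff_dim A"
    and two: "2 * hausdorff_dim A + hausdorff_dim B > 2"
  shows "emeasure lebesgue (distance_set (A \<times> B)) > 0"
proof -
  define a b where "a = hausdorff_dim A" and "b = hausdorff_dim B"
  \<comment> \<open>Lowering both exponents by \<open>e\<close> costs \<open>3 * e\<close>, half of
    the surplus over \<open>2\<close>.\<close>
  define e where "e = (2 * a + b - 2) / 6"
  have a: "a > 2 / 3" using less two by (simp add: a_def b_def)
  have e: "e > 0" using two by (simp add: a_def b_def e_def)
  \<comment> \<open>The floor \<open>1 / 3\<close> keeps \<open>s\<close> positive and, as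
    \<open>a > 2 / 3\<close>, below the dimension.\<close>
  define s where "s = max (a - e) (1 / 3)"
  have s: "s > 0" "s < a" "s \<ge> a - e" using a e by (auto simp: s_def)
  define t where "t = max 0 (b - e)"
  have HB: "hausdorff_measure t B > 0"
  proof (cases "b - e \<ge> 0")
    case True
    then show ?thesis using e by (intro hausdorff_measure_pos_below_dim) (auto simp: t_def b_def)
  next
    case False
    then show ?thesis using hausdorff_measure_0_pos[OF \<open>B \<noteq> {}\<close>] by (simp add: t_def)
  qed
  have HA: "hausdorff_measure s A > 0"
    using s by (intro hausdorff_measure_pos_below_dim) (auto simp: a_def)
  have "2 * s + t \<ge> 2 * (a - e) + (b - e)" using s(3) by (simp add: t_def)
  also have "2 * (a - e) + (b - e) = 2 + 3 * e" by (simp add: e_def field_simps)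
  finally have "2 * s + t > 2" using e by simp
  then show ?thesis
    using pos_distance_set_Times[OF A B s(1) _ HA HB] by (simp add: t_def)
qed

theorem theorem1p1:
  fixes A B :: "real set"
  assumes "compact A" and "compact B"
  shows "(\<forall>s\<^sub>A\<ge>0. \<forall>s\<^sub>B\<ge>0.
            hausdorff_measure s\<^sub>A A > 0 \<longrightarrow> hausdorff_measure s\<^sub>B B > 0 \<longrightarrow>
            s\<^sub>A + s\<^sub>B + max s\<^sub>A s\<^sub>B > 2 \<longrightarrow>
            emeasure lebesgue (distance_set (A \<times> B)) > 0)
       \<and> (hausdorff_dim (A \<times> B) = hausdorff_dim A + hausdorff_dim B \<longrightarrow>
            hausdorff_dim A \<noteq> hausdorff_dim B \<longrightarrow>
            hausdorff_dim (A \<times> B) > 4 / 3 - \<bar>hausdorff_dim A - hausdorff_dim B\<bar> / 3 \<longrightarrow>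
            emeasure lebesgue (distance_set (A \<times> B)) > 0)"
proof (intro conjI allI impI)
  fix s t :: real
  assume st: "s \<ge> 0" "t \<ge> 0" "hausdorff_measure s A > 0" "hausdorff_measure t B > 0" "s + t + max s t > 2"
  show "emeasure lebesgue (distance_set (A \<times> B)) > 0"
  proof (cases "t \<le> s")
    case True
    \<comment> \<open>For \<open>t \<le> s\<close> the hypothesis reads
      \<open>2 * s + t > 2\<close>, which also forces \<open>s > 0\<close>.\<close>
    then show ?thesis
      using st pos_distance_set_Times[OF assms, of s t] by auto
  next
    case False
    then show ?thesis
      using st pos_distance_set_Times[OF assms(2,1), of t s] by (auto simp: distance_set_swap[of A])
  qed
next
  assume dim: "hausdorff_dim (A \<times> B) = hausdorff_dim A + hausdorff_dim B"
    and ne: "hausdorff_dim A \<noteq> hausdorff_dim B"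
    and gt: "hausdorff_dim (A \<times> B) > 4 / 3 - \<bar>hausdorff_dim A - hausdorff_dim B\<bar> / 3"
  \<comment> \<open>If one set were empty, the product would be too, and additivity would make both
    dimensions 0.\<close>
  have "A \<noteq> {}" "B \<noteq> {}" using dim ne by (auto simp: hausdorff_dim_empty)
  show "emeasure lebesgue (distance_set (A \<times> B)) > 0"
  proof (cases "hausdorff_dim B < hausdorff_dim A")
    case True
    \<comment> \<open>With the absolute value resolved, the threshold is this inequality multiplied
      by \<open>2 / 3\<close>.\<close>
    then have "2 * hausdorff_dim A + hausdorff_dim B > 2" using dim gt by (simp add: field_simps)
    with True \<open>B \<noteq> {}\<close> show ?thesis by (intro pos_distance_set_of_dim assms)
  next
    case False
    then have less: "hausdorff_dim A < hausdorff_dim B" using ne by simp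
    then have "2 * hausdorff_dim B + hausdorff_dim A > 2" using dim gt by (simp add: field_simps)
    with less \<open>A \<noteq> {}\<close> have "emeasure lebesgue (distance_set (B \<times> A)) > 0"
      by (intro pos_distance_set_of_dim assms)
    then show ?thesis by (simp add: distance_set_swap[of A])
  qed
qed

end
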